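(* Let $d \in \mathbb{N} \cup \{\infty\}$, let $\gamma \in (0,\infty)$, let $K(z,w) = (1-\langle z,w\rangle)^{-\gamma}$ be the reproducing kernel of $\mathcal{H}_\gamma$ on $\mathbb{B}_d$, and let $\phi: \mathbb{B}_d \to \mathbb{B}_d$ and $\delta: \mathbb{B}_d \to \mathbb{C}$ be arbitrary maps. The following are equivalent: (i) $W_{\delta,\phi}$ is a co-isometry on $\mathcal{H}_\gamma$; (ii) there exist $a \in \mathbb{B}_d$ and a linear isometry $V$ on $\mathbb{C}^d$ such that $\phi = \varphi_a \circ V$ on $\mathbb{B}_d$ and $\delta(z) = \mu \dfrac{K(Vz,a)}{K(a,a)^{1/2}}$ for all $z \in \mathbb{B}_d$, for some $\mu \in \mathbb{C}$ with $|\mu| = 1$.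
   Context: For $d \in \mathbb{N}$, $\mathbb{B}_d$ is the Euclidean open unit ball of $\mathbb{C}^d$; for $d = \infty$, $\mathbb{C}^\infty$ is understood as $\ell^2$ and $\mathbb{B}_\infty$ is its open unit ball. Inner products are linear in the first variable. $\mathcal{H}_\gamma$ is the reproducing kernel Hilbert space of functions on $\mathbb{B}_d$ with kernel $K(z,w) = (1-\langle z,w\rangle)^{-\gamma}$ (principal branch). The weighted composition operator $W_{\delta,\phi}$ is $f \mapsto \delta\cdot(f\circ\phi)$. Saying that it is a co-isometry on $\mathcal{H}_\gamma$ includes the assertion that it is well defined, i.e. maps $\mathcal{H}_\gamma$ into itself; a bounded operator $T$ is a co-isometry if $T^*$ is an isometry ($TT^*=I$). For $a \in \mathbb{B}_d$, let $P_a$ be the orthogonal projection onto the linear span of $a$, $Q_a = I - P_a$, $s_a = (1-\|a\|^2)^{1/2}$, and $$\varphi_a(z) = \frac{a - P_a z - s_a Q_a z}{1 - \langle z,a\rangle} \quad (z \in \mathbb{B}_d),$$ an involutive biholomorphic automorphism of $\mathbb{B}_d$ mapping $0$ to $a$. A linear isometry need not be surjective when $d=\infty$. *)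

theory Defs
  imports "HOL-Analysis.Analysis" "HOL-Library.Extended_Nat" "HOL-Library.FuncSet"
begin

section \<open>Complex Hilbert spaces of functions\<close>

text \<open>
  The spaces here are complex vector spaces of functions with pointwise operations, given by a
  carrier set \<open>H\<close> and an inner product \<open>ip\<close>. Neither \<open>ip\<close> nor an operator is constrained outside
  the carrier.
\<close>

definition ip_norm :: "(('a \<Rightarrow> complex) \<Rightarrow> ('a \<Rightarrow> complex) \<Rightarrow> complex) \<Rightarrow> ('a \<Rightarrow> complex) \<Rightarrow> real" where
  "ip_norm ip f = sqrt (Re (ip f f))"

locale function_hilbert_space =
  fixes H :: "('a \<Rightarrow> complex) set"
    and ip :: "('a \<Rightarrow> complex) \<Rightarrow> ('a \<Rightarrow> complex) \<Rightarrow> complex"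
  assumes zero_mem: "(\<lambda>_. 0) \<in> H"
    and add_mem: "\<lbrakk>f \<in> H; g \<in> H\<rbrakk> \<Longrightarrow> (\<lambda>x. f x + g x) \<in> H"
    and scale_mem: "f \<in> H \<Longrightarrow> (\<lambda>x. c * f x) \<in> H"
    and ip_add: "\<lbrakk>f \<in> H; g \<in> H; h \<in> H\<rbrakk> \<Longrightarrow> ip (\<lambda>x. f x + g x) h = ip f h + ip g h"
    and ip_scale: "\<lbrakk>f \<in> H; h \<in> H\<rbrakk> \<Longrightarrow> ip (\<lambda>x. c * f x) h = c * ip f h"
    and ip_commute: "\<lbrakk>f \<in> H; g \<in> H\<rbrakk> \<Longrightarrow> ip g f = cnj (ip f g)"
    and ip_nonneg: "f \<in> H \<Longrightarrow> 0 \<le> Re (ip f f)"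
    and ip_definite: "\<lbrakk>f \<in> H; ip f f = 0\<rbrakk> \<Longrightarrow> f = (\<lambda>_. 0)"
    and ip_complete:
      "\<lbrakk>\<And>n. F n \<in> H;
        \<forall>e>0. \<exists>N. \<forall>m\<ge>N. \<forall>n\<ge>N. ip_norm ip (\<lambda>x. F m x - F n x) < e\<rbrakk>
       \<Longrightarrow> \<exists>f\<in>H. (\<lambda>n. ip_norm ip (\<lambda>x. F n x - f x)) \<longlonglongrightarrow> 0"

text \<open>
  A function on \<open>X\<close> is represented by its extension by zero to the whole type. By the
  Moore-Aronszajn theorem a positive definite kernel has exactly one such space \<open>(H, ip)\<close>, up to
  values of \<open>ip\<close> outside \<open>H\<close>.
\<close>

locale reproducing_kernel_hilbert_space = function_hilbert_space H ip
  for H :: "('a \<Rightarrow> complex) set"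
    and ip :: "('a \<Rightarrow> complex) \<Rightarrow> ('a \<Rightarrow> complex) \<Rightarrow> complex" +
  fixes X :: "'a set" and K :: "'a \<Rightarrow> 'a \<Rightarrow> complex"
  assumes zero_outside: "\<lbrakk>f \<in> H; z \<notin> X\<rbrakk> \<Longrightarrow> f z = 0"
    and kernel_mem: "w \<in> X \<Longrightarrow> (\<lambda>z. if z \<in> X then K z w else 0) \<in> H"
    and reproducing: "\<lbrakk>f \<in> H; w \<in> X\<rbrakk> \<Longrightarrow> ip f (\<lambda>z. if z \<in> X then K z w else 0) = f w"

definition linear_map_on ::
    "('a \<Rightarrow> complex) set \<Rightarrow> (('a \<Rightarrow> complex) \<Rightarrow> ('a \<Rightarrow> complex)) \<Rightarrow> bool" where
  "linear_map_on H T \<longleftrightarrow>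
     T \<in> H \<rightarrow> H \<and>
     (\<forall>f\<in>H. \<forall>g\<in>H. T (\<lambda>x. f x + g x) = (\<lambda>x. T f x + T g x)) \<and>
     (\<forall>f\<in>H. \<forall>c. T (\<lambda>x. c * f x) = (\<lambda>x. c * T f x))"

definition bounded_operator_on where
  "bounded_operator_on H ip T \<longleftrightarrow>
     linear_map_on H T \<and> (\<exists>C. \<forall>f\<in>H. ip_norm ip (T f) \<le> C * ip_norm ip f)"

definition linear_isometry_on where
  "linear_isometry_on H ip T \<longleftrightarrow>
     linear_map_on H T \<and> (\<forall>f\<in>H. ip_norm ip (T f) = ip_norm ip f)"

text \<open>\<open>S\<close> is the adjoint of \<open>T\<close>; on a Hilbert space this determines \<open>S\<close> on \<open>H\<close>.\<close>

definition adjoint_on ::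
    "('a \<Rightarrow> complex) set \<Rightarrow> (('a \<Rightarrow> complex) \<Rightarrow> ('a \<Rightarrow> complex) \<Rightarrow> complex) \<Rightarrow>
     (('a \<Rightarrow> complex) \<Rightarrow> ('a \<Rightarrow> complex)) \<Rightarrow> (('a \<Rightarrow> complex) \<Rightarrow> ('a \<Rightarrow> complex)) \<Rightarrow> bool" where
  "adjoint_on H ip T S \<longleftrightarrow> S \<in> H \<rightarrow> H \<and> (\<forall>f\<in>H. \<forall>g\<in>H. ip (T f) g = ip f (S g))"

definition coisometry_on where
  "coisometry_on H ip T \<longleftrightarrow>
     bounded_operator_on H ip T \<and> (\<exists>S. adjoint_on H ip T S \<and> linear_isometry_on H ip S)"

definition orthogonal_projection ::
    "(('a \<Rightarrow> complex) \<Rightarrow> ('a \<Rightarrow> complex) \<Rightarrow> complex) \<Rightarrow> ('a \<Rightarrow> complex) set \<Rightarrow>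
     ('a \<Rightarrow> complex) \<Rightarrow> ('a \<Rightarrow> complex)" where
  "orthogonal_projection ip M x = (THE p. p \<in> M \<and> (\<forall>m\<in>M. ip (\<lambda>i. x i - p i) m = 0))"

section \<open>The space \<open>\<complex>\<^sup>d\<close> for finite or infinite \<open>d\<close>, and its unit ball\<close>

text \<open>
  Vectors are sequences indexed from 0 that vanish from index \<open>d\<close> on. For \<open>d = \<infinity>\<close> this is
  \<open>\<ell>\<^sup>2\<close>; for finite \<open>d\<close> the summability condition holds automatically.
\<close>

definition Cspace :: "enat \<Rightarrow> (nat \<Rightarrow> complex) set" where
  "Cspace d = {x. (\<forall>i. d \<le> enat i \<longrightarrow> x i = 0) \<and> summable (\<lambda>i. (cmod (x i))\<^sup>2)}"

definition cinner :: "(nat \<Rightarrow> complex) \<Rightarrow> (nat \<Rightarrow> complex) \<Rightarrow> complex" where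
  "cinner x y = (\<Sum>i. x i * cnj (y i))"

definition Cball :: "enat \<Rightarrow> (nat \<Rightarrow> complex) set" where
  "Cball d = {z \<in> Cspace d. ip_norm cinner z < 1}"

definition ball_kernel :: "real \<Rightarrow> (nat \<Rightarrow> complex) \<Rightarrow> (nat \<Rightarrow> complex) \<Rightarrow> complex" where
  "ball_kernel \<gamma> z w = (1 - cinner z w) powr (- complex_of_real \<gamma>)"

definition ball_automorphism :: "(nat \<Rightarrow> complex) \<Rightarrow> (nat \<Rightarrow> complex) \<Rightarrow> (nat \<Rightarrow> complex)" where
  "ball_automorphism a z =
     (let Pz = orthogonal_projection cinner (range (\<lambda>c i. c * a i)) z;
          Qz = (\<lambda>i. z i - Pz i);
          s = sqrt (1 - (ip_norm cinner a)\<^sup>2)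
      in (\<lambda>i. (a i - Pz i - complex_of_real s * Qz i) / (1 - cinner z a)))"

definition weighted_composition ::
    "'a set \<Rightarrow> ('a \<Rightarrow> complex) \<Rightarrow> ('a \<Rightarrow> 'a) \<Rightarrow> ('a \<Rightarrow> complex) \<Rightarrow> ('a \<Rightarrow> complex)" where
  "weighted_composition X \<delta> \<phi> f = (\<lambda>z. if z \<in> X then \<delta> z * f (\<phi> z) else 0)"

lemma summable_cinner:
  assumes "x \<in> Cspace d" "y \<in> Cspace d"
  shows "summable (\<lambda>i. x i * cnj (y i))"
proof (rule summable_comparison_test')
  show "summable (\<lambda>i. (cmod (x i))\<^sup>2 + (cmod (y i))\<^sup>2)"
    using assms by (auto simp: Cspace_def intro: summable_add)
  fix n assume "n \<ge> (0::nat)"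
  have "2 * cmod (x n) * cmod (y n) \<le> (cmod (x n))\<^sup>2 + (cmod (y n))\<^sup>2"
    by (rule sum_squares_bound)
  moreover have "0 \<le> cmod (x n) * cmod (y n)" by simp
  ultimately show "norm (x n * cnj (y n)) \<le> (cmod (x n))\<^sup>2 + (cmod (y n))\<^sup>2"
    unfolding norm_mult complex_mod_cnj by linarith
qed

lemma cinner_self:
  assumes "x \<in> Cspace d"
  shows "cinner x x = complex_of_real (\<Sum>i. (cmod (x i))\<^sup>2)"
  using assms unfolding cinner_def Cspace_def
  by (simp add: suminf_of_real complex_norm_square[symmetric])

lemma cinner_self_eq_0:
  assumes "x \<in> Cspace d"
  shows "cinner x x = 0 \<longleftrightarrow> x = (\<lambda>_. 0)"
proof -
  have "(\<Sum>i. (cmod (x i))\<^sup>2) = 0 \<longleftrightarrow> (\<forall>i. (cmod (x i))\<^sup>2 = 0)"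
    using assms by (intro suminf_eq_zero_iff) (auto simp: Cspace_def)
  then show ?thesis
    unfolding cinner_self[OF assms] by (auto simp: fun_eq_iff)
qed

lemma orthogonal_projection_line:
  assumes "x \<in> Cspace d" "a \<in> Cspace d"
  shows "orthogonal_projection cinner (range (\<lambda>c i. c * a i)) x =
           (\<lambda>i. cinner x a / cinner a a * a i)"
proof -
  have *: "cinner (\<lambda>i. x i - c * a i) (\<lambda>i. e * a i) = cnj e * (cinner x a - c * cinner a a)"
    for c e
  proof -
    have "(\<Sum>i. cnj e * (x i * cnj (a i) - c * (a i * cnj (a i)))) =
            cnj e * (cinner x a - c * cinner a a)"
      using summable_cinner[OF assms] summable_cinner[OF assms(2) assms(2)]
      unfolding cinner_def by (simp add: suminf_mult suminf_diff[symmetric] summable_diff summable_mult)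
    then show ?thesis
      unfolding cinner_def by (simp add: algebra_simps)
  qed
  show ?thesis
  proof (cases "a = (\<lambda>_. 0)")
    case True
    then show ?thesis
      unfolding orthogonal_projection_def by (auto simp: cinner_def image_def)
  next
    case False
    then have nz: "cinner a a \<noteq> 0"
      using cinner_self_eq_0[OF assms(2)] by simp
    show ?thesis
      unfolding orthogonal_projection_def
    proof (rule the_equality)
      show "(\<lambda>i. cinner x a / cinner a a * a i) \<in> range (\<lambda>c i. c * a i) \<and>
         (\<forall>m\<in>range (\<lambda>c i. c * a i). cinner (\<lambda>i. x i - cinner x a / cinner a a * a i) m = 0)"
      proof -
        have "cinner x a / cinner a a * cinner a a = cinner x a" using nz by simp
        then show ?thesis
          using *[of "cinner x a / cinner a a"] by (auto simp del: times_divide_eq_left)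
      qed
    next
      fix p
      assume p: "p \<in> range (\<lambda>c i. c * a i) \<and>
        (\<forall>m\<in>range (\<lambda>c i. c * a i). cinner (\<lambda>i. x i - p i) m = 0)"
      then obtain c where c: "p = (\<lambda>i. c * a i)" by auto
      have "cinner (\<lambda>i. x i - c * a i) (\<lambda>i. 1 * a i) = 0"
        using p unfolding c by blast
      then have "cinner x a - c * cinner a a = 0"
        unfolding * by simp
      then show "p = (\<lambda>i. cinner x a / cinner a a * a i)"
        using nz c by (simp add: field_simps)
    qed
  qed
qed

end

theory Submission
  imports Defs
begin

text \<open>
  On any reproducing kernel Hilbert space, \<open>W\<^sub>\<delta>\<^sub>,\<^sub>\<phi>\<close> is a co-isometry iff
  \<open>\<delta>(z) cnj(\<delta>(w)) K(\<phi> z, \<phi> w) = K(z, w)\<close>, since its adjoint sends \<open>K\<^sub>w\<close> to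
  \<open>cnj(\<delta>(w)) K\<^bsub>\<phi> w\<^esub>\<close>. On the ball, the identity for \<open>1 - \<langle>\<phi>\<^sub>a z, \<phi>\<^sub>a w\<rangle>\<close> turns this condition, with
  \<open>a = \<phi>(0)\<close> and \<open>\<psi> = \<phi>\<^sub>a \<circ> \<phi>\<close>, into the stated formula for \<open>\<delta>\<close> together with
  \<open>K(\<psi> z, \<psi> w) = K(z, w)\<close>; the latter forces \<open>\<psi>\<close> to preserve inner products, hence to be the
  restriction of a linear isometry.
\<close>

section \<open>Inner product spaces of functions\<close>

text \<open>The difficult half of the kernel criterion is the one that starts from the identity.
  There \<open>W\<close> is only a pointwise formula, with no regularity of \<open>\<delta>\<close>
  or \<open>\<phi>\<close>, so neither \<open>W f\<close> in \<open>H\<close> nor an adjoint is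
  available; both have to be extracted from the identity. On the ball the obstacle is the principal
  power. Once \<open>\<gamma>\<close> exceeds 2, different values of \<open>1 - <z,w>\<close> can
  have the same power, so equal kernels yield equal inner products directly only where these are
  small, and a scaling argument must carry the result to the whole ball. The point
  \<open>\<phi>(0)\<close> is the right choice of \<open>a\<close> because
  \<open>K(z,0) = 1\<close>: the identity at \<open>w = 0\<close> then determines
  \<open>\<delta>\<close> up to a unimodular constant. For infinite \<open>d\<close> the isometry
  may have a proper range, so its linearity is derived from the preservation of inner products
  alone.\<close>

locale function_inner_product_space =
  fixes H :: "('a \<Rightarrow> complex) set"
    and ip :: "('a \<Rightarrow> complex) \<Rightarrow> ('a \<Rightarrow> complex) \<Rightarrow> complex"
  assumes add_mem: "\<lbrakk>f \<in> H; g \<in> H\<rbrakk> \<Longrightarrow> (\<lambda>x. f x + g x) \<in> H"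
    and scale_mem: "f \<in> H \<Longrightarrow> (\<lambda>x. c * f x) \<in> H"
    and ip_add: "\<lbrakk>f \<in> H; g \<in> H; h \<in> H\<rbrakk> \<Longrightarrow> ip (\<lambda>x. f x + g x) h = ip f h + ip g h"
    and ip_scale: "\<lbrakk>f \<in> H; h \<in> H\<rbrakk> \<Longrightarrow> ip (\<lambda>x. c * f x) h = c * ip f h"
    and ip_commute: "\<lbrakk>f \<in> H; g \<in> H\<rbrakk> \<Longrightarrow> ip g f = cnj (ip f g)"
    and ip_nonneg: "f \<in> H \<Longrightarrow> 0 \<le> Re (ip f f)"
    and ip_definite: "\<lbrakk>f \<in> H; ip f f = 0\<rbrakk> \<Longrightarrow> f = (\<lambda>_. 0)"
begin

section \<open>Calculus of inner products and norms, shared by \<open>H\<close> and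
  \<open>Cspace d\<close>\<close>

lemma diff_mem:
  assumes "f \<in> H" "g \<in> H"
  shows "(\<lambda>x. f x - g x) \<in> H"
  using add_mem[OF assms(1) scale_mem[OF assms(2), of "-1"]] by simp

lemma ip_diff:
  assumes "f \<in> H" "g \<in> H" "h \<in> H"
  shows "ip (\<lambda>x. f x - g x) h = ip f h - ip g h"
  using ip_add[OF assms(1) scale_mem[OF assms(2), of "-1"] assms(3)]
    ip_scale[OF assms(2,3), of "-1"] by simp

lemma ip_add_right:
  assumes "f \<in> H" "g \<in> H" "h \<in> H"
  shows "ip h (\<lambda>x. f x + g x) = ip h f + ip h g"
  by (simp add: ip_commute[OF add_mem[OF assms(1,2)] assms(3)] ip_add[OF assms]
      ip_commute[OF assms(1,3)] ip_commute[OF assms(2,3)])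

lemma ip_diff_right:
  assumes "f \<in> H" "g \<in> H" "h \<in> H"
  shows "ip h (\<lambda>x. f x - g x) = ip h f - ip h g"
  by (simp add: ip_commute[OF diff_mem[OF assms(1,2)] assms(3)] ip_diff[OF assms]
      ip_commute[OF assms(1,3)] ip_commute[OF assms(2,3)])

lemma ip_scale_right:
  assumes "f \<in> H" "h \<in> H"
  shows "ip h (\<lambda>x. c * f x) = cnj c * ip h f"
  by (simp add: ip_commute[OF scale_mem[OF assms(1)] assms(2)] ip_scale[OF assms]
      ip_commute[OF assms])

lemmas ip_linear = add_mem scale_mem diff_mem
  ip_add ip_scale ip_diff ip_add_right ip_scale_right ip_diff_right

abbreviation nrm :: "('a \<Rightarrow> complex) \<Rightarrow> real" where "nrm f \<equiv> ip_norm ip f"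

lemma nrm_nonneg: "0 \<le> nrm f" if "f \<in> H"
  using ip_nonneg[OF that] by (simp add: ip_norm_def)

lemma nrm_square: "(nrm f)\<^sup>2 = Re (ip f f)" if "f \<in> H"
  using ip_nonneg[OF that] by (simp add: ip_norm_def)

lemma ip_self: "ip f f = of_real ((nrm f)\<^sup>2)" if "f \<in> H"
  using arg_cong[OF ip_commute[OF that that], of Im] nrm_square[OF that]
  by (simp add: complex_eq_iff)

lemma nrm_eq_0: "f = (\<lambda>_. 0)" if "f \<in> H" "nrm f = 0"
  using ip_definite[OF that(1)] ip_self[OF that(1)] that(2) by simp

lemma eq_if_ip_eq:
  assumes "f \<in> H" "g \<in> H" "\<And>h. h \<in> H \<Longrightarrow> ip h f = ip h g"
  shows "f = g"
proof -
  let ?h = "\<lambda>x. f x - g x"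
  have h: "?h \<in> H" using assms by (simp add: diff_mem)
  have "ip ?h ?h = 0"
    using ip_diff_right[OF assms(1,2) h] assms(3)[OF h] by simp
  from ip_definite[OF h this] show ?thesis by (auto simp: fun_eq_iff)
qed

lemma nrm_diff_square:
  assumes "f \<in> H" "g \<in> H"
  shows "(nrm (\<lambda>x. f x - g x))\<^sup>2 = (nrm f)\<^sup>2 + (nrm g)\<^sup>2 - 2 * Re (ip f g)"
  using assms by (simp add: nrm_square ip_linear ip_commute[OF assms])

lemma nrm_add_square:
  assumes "f \<in> H" "g \<in> H"
  shows "(nrm (\<lambda>x. f x + g x))\<^sup>2 = (nrm f)\<^sup>2 + (nrm g)\<^sup>2 + 2 * Re (ip f g)"
  using assms by (simp add: nrm_square ip_linear ip_commute[OF assms])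

lemma nrm_scale:
  assumes "f \<in> H"
  shows "nrm (\<lambda>x. c * f x) = cmod c * nrm f"
proof -
  have "(nrm (\<lambda>x. c * f x))\<^sup>2 = (cmod c * nrm f)\<^sup>2"
  proof -
    have "ip (\<lambda>x. c * f x) (\<lambda>x. c * f x) = (c * cnj c) * of_real ((nrm f)\<^sup>2)"
      using assms ip_self[OF assms] by (simp add: ip_linear)
    then show ?thesis
      using assms by (simp add: nrm_square[OF scale_mem] complex_norm_square[symmetric]
          power_mult_distrib flip: of_real_mult of_real_power)
  qed
  then show ?thesis
    using assms by (simp add: nrm_nonneg scale_mem)
qed

lemma cauchy_schwarz:
  assumes "f \<in> H" "g \<in> H"
  shows "cmod (ip f g) \<le> nrm f * nrm g"
proof (cases "nrm g = 0")
  case True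
  then have "ip f g = ip f (\<lambda>x. 0 * g x)" using nrm_eq_0[OF assms(2)] by simp
  also have "\<dots> = 0" using ip_scale_right[OF assms(2,1), of 0] by simp
  finally show ?thesis using True by simp
next
  case False
  then have pos: "0 < nrm g" using nrm_nonneg[OF assms(2)] by simp
  \<comment> \<open>The coefficient of the orthogonal projection of \<open>f\<close> onto the line
    of \<open>g\<close>.\<close>
  let ?c = "ip f g / of_real ((nrm g)\<^sup>2)"
  have c: "cmod ?c = cmod (ip f g) / (nrm g)\<^sup>2" by (simp add: norm_divide norm_power)
  have "0 \<le> (nrm (\<lambda>x. f x - ?c * g x))\<^sup>2" by simp
  also have "\<dots> = (nrm f)\<^sup>2 + (cmod ?c * nrm g)\<^sup>2 - 2 * Re (cnj ?c * ip f g)"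
    using assms by (simp only: nrm_diff_square scale_mem nrm_scale ip_scale_right)
  also have "cnj ?c * ip f g = of_real ((cmod (ip f g))\<^sup>2 / (nrm g)\<^sup>2)"
    by (simp add: complex_norm_square mult.commute del: of_real_power)
  also have "(cmod ?c * nrm g)\<^sup>2 = (cmod (ip f g))\<^sup>2 / (nrm g)\<^sup>2"
    using pos unfolding c by (simp add: power2_eq_square)
  finally have "(cmod (ip f g))\<^sup>2 / (nrm g)\<^sup>2 \<le> (nrm f)\<^sup>2" by simp
  then have "(cmod (ip f g))\<^sup>2 \<le> (nrm f * nrm g)\<^sup>2"
    using pos by (simp add: field_simps power_mult_distrib)
  then show ?thesis
    by (rule power2_le_imp_le) (simp add: assms nrm_nonneg)
qed

lemma nrm_triangle:
  assumes "f \<in> H" "g \<in> H"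
  shows "nrm (\<lambda>x. f x + g x) \<le> nrm f + nrm g"
proof (rule power2_le_imp_le)
  have "Re (ip f g) \<le> nrm f * nrm g"
    using cauchy_schwarz[OF assms] complex_Re_le_cmod order_trans by blast
  then show "(nrm (\<lambda>x. f x + g x))\<^sup>2 \<le> (nrm f + nrm g)\<^sup>2"
    unfolding nrm_add_square[OF assms] by (simp add: power2_sum)
qed (simp add: assms nrm_nonneg)

lemma nrm_triangle_diff:
  assumes "f \<in> H" "g \<in> H" "h \<in> H"
  shows "nrm (\<lambda>x. f x - h x) \<le> nrm (\<lambda>x. f x - g x) + nrm (\<lambda>x. g x - h x)"
  using nrm_triangle[OF diff_mem[OF assms(1,2)] diff_mem[OF assms(2,3)]] by simp

lemma nrm_minus_commute:
  assumes "f \<in> H" "g \<in> H"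
  shows "nrm (\<lambda>x. f x - g x) = nrm (\<lambda>x. g x - f x)"
  using nrm_scale[OF diff_mem[OF assms], of "-1"] by simp

section \<open>Convergence in norm and continuity of the inner product\<close>

abbreviation converges :: "(nat \<Rightarrow> 'a \<Rightarrow> complex) \<Rightarrow> ('a \<Rightarrow> complex) \<Rightarrow> bool" where
  "converges F f \<equiv> (\<lambda>n. nrm (\<lambda>x. F n x - f x)) \<longlonglongrightarrow> 0"

lemma tendsto_ip:
  assumes "\<And>n. F n \<in> H" "f \<in> H" "g \<in> H" "converges F f"
  shows "(\<lambda>n. ip (F n) g) \<longlonglongrightarrow> ip f g"
proof (rule LIM_zero_cancel, rule Lim_null_comparison)
  show "\<forall>\<^sub>F n in sequentially. norm (ip (F n) g - ip f g) \<le> nrm (\<lambda>x. F n x - f x) * nrm g"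
    using cauchy_schwarz[OF diff_mem[OF assms(1,2)] assms(3)] assms
    by (simp add: ip_diff)
  show "(\<lambda>n. nrm (\<lambda>x. F n x - f x) * nrm g) \<longlonglongrightarrow> 0"
    using assms(4) by (rule tendsto_mult_left_zero)
qed

lemma tendsto_ip_right:
  assumes "\<And>n. F n \<in> H" "f \<in> H" "g \<in> H" "converges F f"
  shows "(\<lambda>n. ip g (F n)) \<longlonglongrightarrow> ip g f"
  using tendsto_cnj[OF tendsto_ip[OF assms]]
  by (simp only: ip_commute[OF assms(1,3), symmetric] ip_commute[OF assms(2,3), symmetric])

lemma converges_Cauchy:
  assumes "\<And>n. F n \<in> H" "f \<in> H" "converges F f"
  shows "\<forall>e>0. \<exists>N. \<forall>m\<ge>N. \<forall>n\<ge>N. nrm (\<lambda>x. F m x - F n x) < e"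
proof (intro allI impI)
  fix e :: real assume "0 < e"
  then obtain N where N: "\<And>n. n \<ge> N \<Longrightarrow> nrm (\<lambda>x. F n x - f x) < e / 2"
    using order_tendstoD(2)[OF assms(3), of "e/2"] by (auto simp: eventually_sequentially)
  have "nrm (\<lambda>x. F m x - F n x) < e" if "m \<ge> N" "n \<ge> N" for m n
    using nrm_triangle_diff[OF assms(1)[of m] assms(2) assms(1)[of n]]
      nrm_minus_commute[OF assms(2) assms(1)[of n]] N[OF that(1)] N[OF that(2)] by simp
  then show "\<exists>N. \<forall>m\<ge>N. \<forall>n\<ge>N. nrm (\<lambda>x. F m x - F n x) < e" by blast
qed

text \<open>Polarization: the norms of \<open>f + g\<close> and of its image give the real part, and
  replacing \<open>f\<close> by \<open>\<i> f\<close> turns the imaginary part into a real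
  one.\<close>

lemma isometry_preserves_ip:
  assumes T: "linear_isometry_on H ip T" and f: "f \<in> H" and g: "g \<in> H"
  shows "ip (T f) (T g) = ip f g"
proof -
  have TH: "T h \<in> H" and Tn: "nrm (T h) = nrm h" if "h \<in> H" for h
    using T that by (auto simp: linear_isometry_on_def linear_map_on_def)
  have Re: "Re (ip (T f) (T g)) = Re (ip f g)" if "f \<in> H" for f
  proof -
    have "T (\<lambda>x. f x + g x) = (\<lambda>x. T f x + T g x)"
      using T that g by (auto simp: linear_isometry_on_def linear_map_on_def)
    then have "(nrm (\<lambda>x. T f x + T g x))\<^sup>2 = (nrm (\<lambda>x. f x + g x))\<^sup>2"
      using Tn[OF add_mem[OF that g]] by simp
    then show ?thesis
      using that g by (simp add: nrm_add_square TH Tn)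
  qed
  have "T (\<lambda>x. \<i> * f x) = (\<lambda>x. \<i> * T f x)"
    using T f by (auto simp: linear_isometry_on_def linear_map_on_def)
  then have "Re (\<i> * ip (T f) (T g)) = Re (\<i> * ip f g)"
    using Re[OF scale_mem[OF f, of \<i>]] f g TH by (simp add: ip_scale)
  then show ?thesis
    using Re[OF f] by (simp add: complex_eq_iff)
qed

text \<open>Linearity is automatic: expanding the inner product of
  \<open>T (f + g) - T f - T g\<close> with itself leaves only inner products of the arguments,
  which cancel. This serves maps that are not visibly linear: an adjoint obtained by choice and an
  extension obtained by rescaling.\<close>

lemma linear_isometryI:
  assumes T: "T \<in> H \<rightarrow> H" and ip: "\<And>f g. f \<in> H \<Longrightarrow> g \<in> H \<Longrightarrow> ip (T f) (T g) = ip f g"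
  shows "linear_isometry_on H ip T"
proof -
  have TH: "T h \<in> H" if "h \<in> H" for h using T that by auto
  have zero: "f = g" if "f \<in> H" "g \<in> H" "ip (\<lambda>x. f x - g x) (\<lambda>x. f x - g x) = 0" for f g
    using ip_definite[OF diff_mem[OF that(1,2)] that(3)] by (auto simp: fun_eq_iff)
  have "T (\<lambda>x. f x + g x) = (\<lambda>x. T f x + T g x)" if "f \<in> H" "g \<in> H" for f g
    using that by (intro zero) (simp_all add: TH ip_linear ip)
  moreover have "T (\<lambda>x. c * f x) = (\<lambda>x. c * T f x)" if "f \<in> H" for f c
    using that by (intro zero) (simp_all add: TH ip_linear ip algebra_simps)
  moreover have "nrm (T f) = nrm f" if "f \<in> H" for f
    using ip[OF that that] by (simp add: ip_norm_def)
  ultimately show ?thesis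
    using T unfolding linear_isometry_on_def linear_map_on_def by blast
qed

end

sublocale function_hilbert_space \<subseteq> function_inner_product_space
  by unfold_locales
    (fact add_mem scale_mem ip_add ip_scale ip_commute ip_nonneg ip_definite)+

context function_hilbert_space
begin

text \<open>The sequence minimises the distance from \<open>f\<close> to \<open>D\<close>; it is Cauchy by the parallelogram law.\<close>

lemma orthogonal_decomposition:
  assumes D: "D \<subseteq> H" "D \<noteq> {}"
    and D_add: "\<And>g h. g \<in> D \<Longrightarrow> h \<in> D \<Longrightarrow> (\<lambda>x. g x + h x) \<in> D"
    and D_scale: "\<And>g c. g \<in> D \<Longrightarrow> (\<lambda>x. c * g x) \<in> D"
    and f: "f \<in> H"
  shows "\<exists>F p. (\<forall>n. F n \<in> D) \<and> p \<in> H \<and> converges F p \<and> (\<forall>g\<in>D. ip (\<lambda>x. f x - p x) g = 0)"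
proof -
  define dist where "dist = (INF m\<in>D. (nrm (\<lambda>x. f x - m x))\<^sup>2)"
  have bdd: "bdd_below ((\<lambda>m. (nrm (\<lambda>x. f x - m x))\<^sup>2) ` D)"
    by (rule bdd_belowI2[of _ 0]) simp
  have dist_le: "dist \<le> (nrm (\<lambda>x. f x - m x))\<^sup>2" if "m \<in> D" for m
    unfolding dist_def using bdd that by (rule cINF_lower)
  have "\<exists>m\<in>D. (nrm (\<lambda>x. f x - m x))\<^sup>2 < dist + inverse (real (Suc n))" for n
    using cINF_less_iff[OF D(2) bdd, of "dist + inverse (real (Suc n))"]
    unfolding dist_def by simp
  then obtain F where FD: "\<And>n. F n \<in> D"
    and F: "\<And>n. (nrm (\<lambda>x. f x - F n x))\<^sup>2 < dist + inverse (real (Suc n))"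
    by metis
  have FH: "F n \<in> H" for n using FD D(1) by auto
  have F_dist: "(nrm (\<lambda>x. F m x - F n x))\<^sup>2 < 2 * inverse (real (Suc m)) + 2 * inverse (real (Suc n))"
    for m n
  proof -
    let ?u = "\<lambda>x. f x - F m x" and ?v = "\<lambda>x. f x - F n x"
    \<comment> \<open>The midpoint lies in \<open>D\<close>, so its squared distance from
      \<open>f\<close> is at least \<open>dist\<close>, and \<open>?u + ?v\<close> is twice its
      difference from \<open>f\<close>. The parallelogram law then bounds the squared distance of
      \<open>F m\<close> and \<open>F n\<close> by twice the sum of their excesses over
      \<open>dist\<close>.\<close>
    let ?h = "\<lambda>x. (1/2) * (F m x + F n x)"
    have uv: "?u \<in> H" "?v \<in> H" using f FH by (simp_all add: diff_mem)
    have h: "?h \<in> D" by (intro D_scale D_add FD)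
    have "(\<lambda>x. ?u x + ?v x) = (\<lambda>x. 2 * (f x - ?h x))" by (simp add: fun_eq_iff algebra_simps)
    then have "(nrm (\<lambda>x. ?u x + ?v x))\<^sup>2 = (cmod 2 * nrm (\<lambda>x. f x - ?h x))\<^sup>2"
      using nrm_scale[OF diff_mem[OF f, of ?h], of 2] h D(1) by auto
    then have "4 * dist \<le> (nrm (\<lambda>x. ?u x + ?v x))\<^sup>2"
      using dist_le[OF h] by (simp add: power_mult_distrib)
    moreover have "(\<lambda>x. F m x - F n x) = (\<lambda>x. ?v x - ?u x)" by simp
    ultimately show ?thesis
      using nrm_diff_square[OF uv(2,1)] nrm_add_square[OF uv(2,1)] F[of m] F[of n]
      by (simp add: add.commute)
  qed
  have "\<forall>e>0. \<exists>N. \<forall>m\<ge>N. \<forall>n\<ge>N. nrm (\<lambda>x. F m x - F n x) < e"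
  proof (intro allI impI)
    fix e :: real assume "0 < e"
    then obtain N where N: "inverse (real (Suc N)) < e\<^sup>2 / 4"
      using reals_Archimedean[of "e\<^sup>2 / 4"] by auto
    have "nrm (\<lambda>x. F m x - F n x) < e" if "m \<ge> N" "n \<ge> N" for m n
    proof (rule power2_less_imp_less)
      have "inverse (real (Suc k)) \<le> inverse (real (Suc N))" if "k \<ge> N" for k
        using that by (intro le_imp_inverse_le) auto
      from this[OF that(1)] this[OF that(2)]
      show "(nrm (\<lambda>x. F m x - F n x))\<^sup>2 < e\<^sup>2"
        using F_dist[of m n] N by linarith
    qed (use \<open>0 < e\<close> in simp)
    then show "\<exists>N. \<forall>m\<ge>N. \<forall>n\<ge>N. nrm (\<lambda>x. F m x - F n x) < e" by blast
  qed
  from ip_complete[of F, OF FH this] obtain p where p: "p \<in> H" and lim: "converges F p" ..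
  have "ip (\<lambda>x. f x - p x) g = 0" if g: "g \<in> D" for g
  proof -
    have gH: "g \<in> H" using g D(1) by auto
    let ?c = "ip (\<lambda>x. f x - p x) g"
    \<comment> \<open>\<open>D\<close> need not be closed, so \<open>p\<close> may lie outside it.
      Minimality is therefore tested on \<open>F n + t g\<close>, and the first-variation inequality
      is passed to the limit.\<close>
    have le: "2 * Re (cnj t * ?c) - (cmod t * nrm g)\<^sup>2 \<le> 0" for t
    proof (rule LIMSEQ_le)
      show "(\<lambda>n. inverse (real (Suc n))) \<longlonglongrightarrow> 0" by (rule LIMSEQ_inverse_real_of_nat)
      show "(\<lambda>n. 2 * Re (cnj t * ip (\<lambda>x. f x - F n x) g) - (cmod t * nrm g)\<^sup>2)
          \<longlonglongrightarrow> 2 * Re (cnj t * ?c) - (cmod t * nrm g)\<^sup>2"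
        unfolding ip_diff[OF f FH gH] ip_diff[OF f p gH]
        by (intro tendsto_intros tendsto_ip[OF FH p gH lim])
      have "2 * Re (cnj t * ip (\<lambda>x. f x - F n x) g) - (cmod t * nrm g)\<^sup>2 \<le> inverse (real (Suc n))"
        for n
      proof -
        have "(\<lambda>x. F n x + t * g x) \<in> D" by (intro D_add D_scale FD g)
        from dist_le[OF this]
        have "dist \<le> (nrm (\<lambda>x. (f x - F n x) - t * g x))\<^sup>2" by (simp add: algebra_simps)
        also have "\<dots> = (nrm (\<lambda>x. f x - F n x))\<^sup>2 + (cmod t * nrm g)\<^sup>2
            - 2 * Re (cnj t * ip (\<lambda>x. f x - F n x) g)"
          using f FH gH by (simp only: nrm_diff_square diff_mem scale_mem nrm_scale ip_scale_right)
        finally show ?thesis using F[of n] by simp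
      qed
      then show "\<exists>N. \<forall>n\<ge>N. 2 * Re (cnj t * ip (\<lambda>x. f x - F n x) g) - (cmod t * nrm g)\<^sup>2
          \<le> inverse (real (Suc n))" by blast
    qed
    \<comment> \<open>With \<open>t = r * ?c\<close> the linear term \<open>2 r |?c|^2\<close> must
      beat the quadratic term \<open>r^2 |?c|^2 |g|^2\<close>, for which \<open>r |g|^2 < 2\<close>
      suffices; the summand 1 covers \<open>g = 0\<close>.\<close>
    define r where "r = 1 / (1 + (nrm g)\<^sup>2)"
    have r: "0 < r" "r * (nrm g)\<^sup>2 < 1"
      by (auto simp: r_def add_pos_nonneg field_simps)
    have "Re (cnj (of_real r * ?c) * ?c) = r * (cmod ?c)\<^sup>2"
      unfolding cmod_power2 by (simp add: power2_eq_square algebra_simps)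
    then have "r * (cmod ?c)\<^sup>2 * (2 - r * (nrm g)\<^sup>2) \<le> 0"
      using le[of "of_real r * ?c"] r(1) by (simp add: norm_mult power2_eq_square algebra_simps)
    moreover have "0 < r * (2 - r * (nrm g)\<^sup>2)" using r by simp
    ultimately have "(cmod ?c)\<^sup>2 \<le> 0"
      using mult_le_0_iff[of "(cmod ?c)\<^sup>2" "r * (2 - r * (nrm g)\<^sup>2)"] by (simp add: algebra_simps)
    then show ?thesis by simp
  qed
  with FD p lim show ?thesis by blast
qed

end

section \<open>Co-isometric weighted composition operators\<close>

context reproducing_kernel_hilbert_space
begin

definition kernel_fun :: "'a \<Rightarrow> 'a \<Rightarrow> complex" where
  "kernel_fun w = (\<lambda>z. if z \<in> X then K z w else 0)"

lemma kernel_fun_mem: "w \<in> X \<Longrightarrow> kernel_fun w \<in> H"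
  using kernel_mem by (simp add: kernel_fun_def)

lemma ip_kernel_fun: "f \<in> H \<Longrightarrow> w \<in> X \<Longrightarrow> ip f (kernel_fun w) = f w"
  using reproducing by (simp add: kernel_fun_def)

text \<open>Evaluation is an inner product with a kernel function, hence continuous. This links
  limits in \<open>H\<close> with the operator, which is given pointwise.\<close>

lemma converges_pointwise:
  assumes "\<And>n. F n \<in> H" "f \<in> H" "converges F f"
  shows "(\<lambda>n. F n z) \<longlonglongrightarrow> f z"
proof (cases "z \<in> X")
  case True
  then show ?thesis
    using tendsto_ip[OF assms(1,2) kernel_fun_mem assms(3)] assms by (simp add: ip_kernel_fun)
qed (simp add: assms zero_outside)

lemma coisometry_imp_kernel_identity:
  assumes \<phi>: "\<phi> \<in> X \<rightarrow> X" and co: "coisometry_on H ip (weighted_composition X \<delta> \<phi>)"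
    and z: "z \<in> X" and w: "w \<in> X"
  shows "\<delta> z * cnj (\<delta> w) * K (\<phi> z) (\<phi> w) = K z w"
proof -
  let ?W = "weighted_composition X \<delta> \<phi>"
  obtain S where S: "adjoint_on H ip ?W S" "linear_isometry_on H ip S"
    and W: "\<And>f. f \<in> H \<Longrightarrow> ?W f \<in> H"
    using co by (auto simp: coisometry_on_def bounded_operator_on_def linear_map_on_def)
  have SK: "S (kernel_fun w) = (\<lambda>x. cnj (\<delta> w) * kernel_fun (\<phi> w) x)" if "w \<in> X" for w
  proof (rule eq_if_ip_eq)
    have \<phi>w: "\<phi> w \<in> X" using \<phi> that by auto
    show "S (kernel_fun w) \<in> H"
      using S(1) kernel_fun_mem[OF that] by (auto simp: adjoint_on_def)
    show "(\<lambda>x. cnj (\<delta> w) * kernel_fun (\<phi> w) x) \<in> H"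
      by (intro scale_mem kernel_fun_mem \<phi>w)
    fix h assume h: "h \<in> H"
    have "ip h (S (kernel_fun w)) = ip (?W h) (kernel_fun w)"
      using S(1) kernel_fun_mem[OF that] h by (auto simp: adjoint_on_def)
    also have "\<dots> = \<delta> w * h (\<phi> w)"
      using that by (simp add: ip_kernel_fun W[OF h]) (simp add: weighted_composition_def)
    finally show "ip h (S (kernel_fun w)) = ip h (\<lambda>x. cnj (\<delta> w) * kernel_fun (\<phi> w) x)"
      using h \<phi>w by (simp add: ip_scale_right kernel_fun_mem ip_kernel_fun)
  qed
  have \<phi>X: "\<phi> z \<in> X" "\<phi> w \<in> X" using \<phi> z w by auto
  \<comment> \<open>The order matters: the right side is \<open>kernel_fun w\<close> evaluated at
    \<open>z\<close>, which is \<open>K z w\<close>.\<close>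
  have "ip (S (kernel_fun w)) (S (kernel_fun z)) = ip (kernel_fun w) (kernel_fun z)"
    using isometry_preserves_ip[OF S(2)] z w by (simp add: kernel_fun_mem)
  then have "cnj (\<delta> w) * (\<delta> z * kernel_fun (\<phi> w) (\<phi> z)) = kernel_fun w z"
    using z w \<phi>X by (simp add: SK ip_linear kernel_fun_mem ip_kernel_fun)
  then show ?thesis
    using z \<phi>X by (simp add: kernel_fun_def mult_ac)
qed

text \<open>
  Let \<open>D\<close> be the space of vectors \<open>m\<close> on which \<open>W\<close> preserves all inner products. It is closed and
  contains \<open>cnj (\<delta> w) K\<^sub>\<phi>\<^sub>w\<close>, the \<open>W\<close>-preimage of \<open>K\<^sub>w\<close>, so \<open>W\<close> kills its orthogonal complement and
  maps \<open>D\<close> isometrically onto \<open>H\<close>; the inverse of this map is the adjoint of \<open>W\<close>.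
\<close>

lemma kernel_identity_imp_coisometry:
  assumes \<phi>: "\<phi> \<in> X \<rightarrow> X"
    and K: "\<And>z w. z \<in> X \<Longrightarrow> w \<in> X \<Longrightarrow> \<delta> z * cnj (\<delta> w) * K (\<phi> z) (\<phi> w) = K z w"
  shows "coisometry_on H ip (weighted_composition X \<delta> \<phi>)"
proof -
  define W where "W = weighted_composition X \<delta> \<phi>"
  have W_add: "W (\<lambda>x. f x + g x) = (\<lambda>x. W f x + W g x)" for f g
    by (auto simp: W_def weighted_composition_def algebra_simps)
  have W_scale: "W (\<lambda>x. c * f x) = (\<lambda>x. c * W f x)" for f c
    by (auto simp: W_def weighted_composition_def)
  have W_diff: "W (\<lambda>x. f x - g x) = (\<lambda>x. W f x - W g x)" for f g
    by (auto simp: W_def weighted_composition_def algebra_simps)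
  \<comment> \<open>The test vectors are restricted to those with \<open>W g\<close> in
    \<open>H\<close>, since \<open>W\<close> may so far leave \<open>H\<close>.\<close>
  define D where "D = {m \<in> H. W m \<in> H \<and> (\<forall>g\<in>H. W g \<in> H \<longrightarrow> ip (W g) (W m) = ip g m)}"
  have DH: "D \<subseteq> H" and DW: "\<And>m. m \<in> D \<Longrightarrow> W m \<in> H"
    and D_ip: "\<And>m g. m \<in> D \<Longrightarrow> g \<in> H \<Longrightarrow> W g \<in> H \<Longrightarrow> ip (W g) (W m) = ip g m"
    by (auto simp: D_def)
  have D_add: "(\<lambda>x. g x + h x) \<in> D" if "g \<in> D" "h \<in> D" for g h
    using that by (simp add: D_def W_add ip_linear)
  have D_scale: "(\<lambda>x. c * g x) \<in> D" if "g \<in> D" for g c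
    using that by (simp add: D_def W_scale ip_linear)
  have D_diff: "(\<lambda>x. g x - h x) \<in> D" if "g \<in> D" "h \<in> D" for g h
    using that by (simp add: D_def W_diff ip_linear)
  have D_nrm: "nrm (W m) = nrm m" if "m \<in> D" for m
    using D_ip[OF that _ DW[OF that]] that DH by (auto simp: ip_norm_def)
  have W_zero: "W (\<lambda>_. 0) = (\<lambda>_. 0)"
    by (simp add: W_def weighted_composition_def fun_eq_iff)
  have "ip g (\<lambda>_. 0) = 0" if "g \<in> H" for g
    using ip_scale_right[OF that that, of 0] by simp
  then have "(\<lambda>_. 0) \<in> D"
    using zero_mem by (simp add: D_def W_zero)
  then have D_ne: "D \<noteq> {}" by auto

  have preim: "(\<lambda>x. cnj (\<delta> w) * kernel_fun (\<phi> w) x) \<in> D" (is "?m \<in> D")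
    and W_preim: "W (\<lambda>x. cnj (\<delta> w) * kernel_fun (\<phi> w) x) = kernel_fun w" if w: "w \<in> X" for w
  proof -
    have \<phi>w: "\<phi> w \<in> X" using \<phi> w by auto
    \<comment> \<open>The kernel identity enters the proof only here, as the statement that
      \<open>?m\<close> is a preimage of \<open>kernel_fun w\<close>.\<close>
    show Wm: "W ?m = kernel_fun w"
      using K[OF _ w] \<phi> by (auto simp: W_def weighted_composition_def kernel_fun_def fun_eq_iff mult.assoc)
    have "ip (W g) (kernel_fun w) = ip g ?m" if "g \<in> H" "W g \<in> H" for g
      using that w \<phi>w ip_kernel_fun[OF that(2) w]
      by (simp add: ip_scale_right kernel_fun_mem ip_kernel_fun)
        (simp add: W_def weighted_composition_def)
    then show "?m \<in> D"
      using w \<phi>w by (simp add: D_def Wm kernel_fun_mem scale_mem)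
  qed

  \<comment> \<open>Continuity of \<open>W\<close> is not yet known. Instead, isometry on
    \<open>D\<close> makes \<open>W (F n)\<close> a Cauchy sequence, and pointwise convergence
    identifies its limit as \<open>W p\<close>.\<close>
  have closed: "p \<in> D \<and> converges (\<lambda>n. W (F n)) (W p)"
    if F: "\<And>n. F n \<in> D" and p: "p \<in> H" and lim: "converges F p" for F p
  proof -
    have FH: "F n \<in> H" for n using F DH by auto
    have "nrm (\<lambda>x. W (F m) x - W (F n) x) = nrm (\<lambda>x. F m x - F n x)" for m n
      using D_nrm[OF D_diff[OF F[of m] F[of n]]] by (simp add: W_diff)
    then have "\<forall>e>0. \<exists>N. \<forall>m\<ge>N. \<forall>n\<ge>N. nrm (\<lambda>x. W (F m) x - W (F n) x) < e"
      using converges_Cauchy[OF FH p lim] by simp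
    from ip_complete[of "\<lambda>n. W (F n)", OF DW[OF F] this]
    obtain h where h: "h \<in> H" and lim_h: "converges (\<lambda>n. W (F n)) h" ..
    have "(\<lambda>n. W (F n) z) \<longlonglongrightarrow> W p z" for z
      using converges_pointwise[OF FH p lim]
      by (auto simp: W_def weighted_composition_def intro: tendsto_mult_left)
    then have "W p z = h z" for z
      using converges_pointwise[OF DW[OF F] h lim_h] by (rule LIMSEQ_unique)
    then have Wp: "W p = h" by auto
    have "ip (W g) h = ip g p" if "g \<in> H" "W g \<in> H" for g
    proof (rule LIMSEQ_unique)
      show "(\<lambda>n. ip g (F n)) \<longlonglongrightarrow> ip g p" by (rule tendsto_ip_right[OF FH p that(1) lim])
      show "(\<lambda>n. ip g (F n)) \<longlonglongrightarrow> ip (W g) h"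
        using tendsto_ip_right[OF DW[OF F] h that(2) lim_h] D_ip[OF F that] by simp
    qed
    then show ?thesis using p h lim_h by (simp add: D_def Wp)
  qed

  have reduce: "\<exists>p\<in>D. W f = W p \<and> nrm p \<le> nrm f" if f: "f \<in> H" for f
  proof -
    have "\<exists>F p. (\<forall>n. F n \<in> D) \<and> p \<in> H \<and> converges F p \<and> (\<forall>g\<in>D. ip (\<lambda>x. f x - p x) g = 0)"
      by (intro orthogonal_decomposition DH D_ne D_add D_scale f)
    then obtain F p where FD: "\<forall>n. F n \<in> D" and p: "p \<in> H" and lim: "converges F p"
      and orth: "\<forall>g\<in>D. ip (\<lambda>x. f x - p x) g = 0"
      by (elim exE conjE) (rule that)
    note F = FD[rule_format] p lim and orth = orth[rule_format]
    have pD: "p \<in> D" using closed[OF F] by simp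
    \<comment> \<open>Orthogonality to the preimage of \<open>kernel_fun z\<close> says exactly that
      \<open>\<delta> z * (f - p) (\<phi> z) = 0\<close>. Hence \<open>W f = W p\<close> lies in
      \<open>H\<close>, which is the well-definedness of \<open>W\<close>.\<close>
    have "W (\<lambda>x. f x - p x) z = 0" for z
    proof (cases "z \<in> X")
      case True
      then have "\<phi> z \<in> X" using \<phi> by auto
      then show ?thesis
        using orth[OF preim[OF True]]
        by (simp add: ip_scale_right kernel_fun_mem ip_kernel_fun diff_mem f p True W_def
            weighted_composition_def)
    qed (simp add: W_def weighted_composition_def)
    then have Wf: "W f = W p" unfolding W_diff by (auto simp: fun_eq_iff)
    have "(nrm f)\<^sup>2 = (nrm (\<lambda>x. f x - p x))\<^sup>2 + (nrm p)\<^sup>2"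
      using nrm_add_square[OF diff_mem[OF f F(2)] F(2)] orth[OF pD] by simp
    then have "nrm p \<le> nrm f"
      by (intro power2_le_imp_le[OF _ nrm_nonneg[OF f]]) simp
    with Wf pD show ?thesis by blast
  qed
  have WH: "W f \<in> H" if "f \<in> H" for f using reduce[OF that] DW by metis
  have W_le: "nrm (W f) \<le> nrm f" if "f \<in> H" for f using reduce[OF that] D_nrm by metis
  \<comment> \<open>The decomposition is applied to the image of \<open>D\<close>. That image
    contains all kernel functions, so the orthogonal part of \<open>g\<close> vanishes and
    \<open>g\<close> is a limit of vectors \<open>W (F n)\<close>; isometry on \<open>D\<close>
    makes \<open>F\<close> itself a Cauchy sequence.\<close>
  have onto: "\<exists>m\<in>D. W m = g" if g: "g \<in> H" for g
  proof -
    have "W ` D \<subseteq> H" "W ` D \<noteq> {}" using DW D_ne by auto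
    moreover have "(\<lambda>x. u x + v x) \<in> W ` D" if "u \<in> W ` D" "v \<in> W ` D" for u v
    proof -
      from that obtain u' v' where "u' \<in> D" "v' \<in> D" "u = W u'" "v = W v'" by blast
      then show ?thesis by (intro image_eqI[OF _ D_add[of u' v']]) (simp_all add: W_add)
    qed
    moreover have "(\<lambda>x. c * u x) \<in> W ` D" if "u \<in> W ` D" for u c
    proof -
      from that obtain u' where "u' \<in> D" "u = W u'" by blast
      then show ?thesis by (intro image_eqI[OF _ D_scale[of u' c]]) (simp_all add: W_scale)
    qed
    ultimately have "\<exists>G p. (\<forall>n. G n \<in> W ` D) \<and> p \<in> H \<and> converges G p \<and>
        (\<forall>h\<in>W ` D. ip (\<lambda>x. g x - p x) h = 0)"
      by (intro orthogonal_decomposition g)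
    then obtain G p where G: "\<forall>n. G n \<in> W ` D" and p: "p \<in> H" and lim: "converges G p"
      and orth: "\<forall>h\<in>W ` D. ip (\<lambda>x. g x - p x) h = 0"
      by (elim exE conjE) (rule that)
    have "g z = p z" for z
    proof (cases "z \<in> X")
      case True
      then have "kernel_fun z \<in> W ` D" using preim W_preim by (metis imageI)
      from orth[rule_format, OF this] show ?thesis
        using g p True by (simp add: ip_kernel_fun diff_mem)
    qed (simp add: zero_outside g p)
    then have gp: "g = p" by auto
    from G obtain F where F: "\<And>n. F n \<in> D" "\<And>n. G n = W (F n)"
      unfolding image_iff by metis
    have FH: "F n \<in> H" for n using F(1) DH by auto
    have GH: "G n \<in> H" for n using F DW by simp
    have "nrm (\<lambda>x. F m x - F n x) = nrm (\<lambda>x. G m x - G n x)" for m n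
      using D_nrm[OF D_diff[OF F(1)[of m] F(1)[of n]]] by (simp add: W_diff F(2))
    then have "\<forall>e>0. \<exists>N. \<forall>m\<ge>N. \<forall>n\<ge>N. nrm (\<lambda>x. F m x - F n x) < e"
      using converges_Cauchy[OF GH p lim] by simp
    from ip_complete[of F, OF FH this] obtain m where m: "m \<in> H" "converges F m" ..
    have mD: "m \<in> D" and lim': "converges G (W m)" using closed[OF F(1) m] F(2) by simp_all
    have "W m z = p z" for z
      by (rule LIMSEQ_unique[OF converges_pointwise[OF GH DW[OF mD] lim']
            converges_pointwise[OF GH p lim]])
    then have "W m = p" by auto
    with mD gp show ?thesis by auto
  qed
  then obtain S where S: "\<And>g. g \<in> H \<Longrightarrow> S g \<in> D" "\<And>g. g \<in> H \<Longrightarrow> W (S g) = g" by metis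
  have SH: "S \<in> H \<rightarrow> H" using S(1) DH by auto
  have adj: "ip (W f) g = ip f (S g)" if "f \<in> H" "g \<in> H" for f g
    using D_ip[OF S(1)[OF that(2)] that(1) WH[OF that(1)]] S(2)[OF that(2)] by simp
  have "ip (S f) (S g) = ip f g" if "f \<in> H" "g \<in> H" for f g
    using adj[OF funcset_mem[OF SH that(1)] that(2)] S(2)[OF that(1)] by simp
  then have "linear_isometry_on H ip S" by (rule linear_isometryI[OF SH])
  moreover have "adjoint_on H ip W S" using SH adj by (simp add: adjoint_on_def)
  moreover have "linear_map_on H W" using WH by (auto simp: linear_map_on_def W_add W_scale)
  moreover have "\<forall>f\<in>H. nrm (W f) \<le> 1 * nrm f" using W_le by simp
  ultimately show ?thesis
    unfolding W_def coisometry_on_def bounded_operator_on_def by blast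
qed

end

section \<open>The ball and its automorphisms\<close>

lemma Cspace_scale: "(\<lambda>i. c * x i) \<in> Cspace d" if "x \<in> Cspace d"
  using that by (auto simp: Cspace_def norm_mult power_mult_distrib intro: summable_mult)

lemma Cspace_add:
  assumes "x \<in> Cspace d" "y \<in> Cspace d"
  shows "(\<lambda>i. x i + y i) \<in> Cspace d"
proof -
  have "summable (\<lambda>i. (cmod (x i + y i))\<^sup>2)"
  proof (rule summable_comparison_test')
    show "summable (\<lambda>i. 2 * (cmod (x i))\<^sup>2 + 2 * (cmod (y i))\<^sup>2)"
      using assms by (intro summable_add summable_mult) (auto simp: Cspace_def)
    fix i :: nat assume "i \<ge> 0"
    have "(cmod (x i + y i))\<^sup>2 \<le> (cmod (x i) + cmod (y i))\<^sup>2"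
      by (intro power_mono norm_triangle_ineq) simp
    also have "\<dots> \<le> 2 * (cmod (x i))\<^sup>2 + 2 * (cmod (y i))\<^sup>2"
      using sum_squares_bound[of "cmod (x i)" "cmod (y i)"] by (simp add: power2_sum)
    finally show "norm ((cmod (x i + y i))\<^sup>2) \<le> 2 * (cmod (x i))\<^sup>2 + 2 * (cmod (y i))\<^sup>2"
      by simp
  qed
  then show ?thesis using assms by (auto simp: Cspace_def)
qed

interpretation Cspace: function_inner_product_space "Cspace d" cinner for d
proof
  fix x y z :: "nat \<Rightarrow> complex" and c :: complex
  assume x: "x \<in> Cspace d"
  show "(\<lambda>i. c * x i) \<in> Cspace d" using x by (rule Cspace_scale)
  show "0 \<le> Re (cinner x x)"
    using x unfolding cinner_self[OF x] by (simp add: suminf_nonneg Cspace_def)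
  show "cinner x x = 0 \<Longrightarrow> x = (\<lambda>_. 0)" using cinner_self_eq_0[OF x] by simp
  assume y: "y \<in> Cspace d"
  show "(\<lambda>i. x i + y i) \<in> Cspace d" using x y by (rule Cspace_add)
  show "cinner (\<lambda>i. c * x i) y = c * cinner x y"
    unfolding cinner_def using suminf_mult[OF summable_cinner[OF x y], of c] by (simp add: mult.assoc)
  have "(\<lambda>i. cnj (x i * cnj (y i))) sums cnj (cinner x y)"
    unfolding sums_cnj cinner_def using summable_cinner[OF x y] by (rule summable_sums)
  then show "cinner y x = cnj (cinner x y)"
    unfolding cinner_def by (simp add: sums_iff mult.commute)
  assume z: "z \<in> Cspace d"
  show "cinner (\<lambda>i. x i + y i) z = cinner x z + cinner y z"
    unfolding cinner_def using suminf_add[OF summable_cinner[OF x z] summable_cinner[OF y z]]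
    by (simp add: distrib_right)
qed

lemma Cball_Cspace: "z \<in> Cball d \<Longrightarrow> z \<in> Cspace d"
  by (simp add: Cball_def)

lemma Cball_nrm: "z \<in> Cball d \<Longrightarrow> ip_norm cinner z < 1"
  by (simp add: Cball_def)

lemma zero_Cball: "(\<lambda>_. 0) \<in> Cball d"
  by (simp add: Cball_def Cspace_def ip_norm_def cinner_def)

lemma Cball_scale:
  assumes "z \<in> Cball d" "cmod c \<le> 1"
  shows "(\<lambda>i. c * z i) \<in> Cball d"
proof -
  have "cmod c * ip_norm cinner z \<le> 1 * ip_norm cinner z"
    using assms Cspace.nrm_nonneg[of z d] by (intro mult_right_mono) (auto simp: Cball_def)
  then show ?thesis
    using assms by (auto simp: Cball_def Cspace_scale Cspace.nrm_scale)
qed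

lemma cinner_less_1:
  assumes z: "z \<in> Cball d" and w: "w \<in> Cball d"
  shows "cmod (cinner z w) < 1"
proof -
  have "cmod (cinner z w) \<le> ip_norm cinner z * ip_norm cinner w"
    using z w by (intro Cspace.cauchy_schwarz Cball_Cspace)
  also have "\<dots> \<le> ip_norm cinner z"
    using Cball_nrm[OF w] Cspace.nrm_nonneg[OF Cball_Cspace[OF z]]
    by (simp add: mult_left_le)
  also have "\<dots> < 1" using z by (rule Cball_nrm)
  finally show ?thesis .
qed

text \<open>Places every base of the kernel in the right half plane, where the principal branch is
  well behaved and denominators do not vanish.\<close>

lemma Re_one_minus_cinner: "0 < Re (1 - cinner z w)" if "z \<in> Cball d" "w \<in> Cball d"
  using cinner_less_1[OF that] complex_Re_le_cmod[of "cinner z w"] by simp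

lemma nrm_square_less_1: "(ip_norm cinner z)\<^sup>2 < 1" if "z \<in> Cball d"
  using Cball_nrm[OF that] Cspace.nrm_nonneg[OF Cball_Cspace[OF that]]
  by (simp add: power_less_one_iff abs_square_less_1)

text \<open>The number \<open>s_a\<close>, taken complex so that the computations with the
  automorphism stay in one field.\<close>

definition automorphism_coeff :: "(nat \<Rightarrow> complex) \<Rightarrow> complex" where
  "automorphism_coeff a = complex_of_real (sqrt (1 - (ip_norm cinner a)\<^sup>2))"

lemma automorphism_coeff:
  assumes "a \<in> Cball d"
  shows "cinner a a = 1 - automorphism_coeff a * automorphism_coeff a"
    and "automorphism_coeff a \<noteq> 0" "1 + automorphism_coeff a \<noteq> 0"
    and "cnj (automorphism_coeff a) = automorphism_coeff a"
proof -
  have pos: "0 < sqrt (1 - (ip_norm cinner a)\<^sup>2)"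
    using nrm_square_less_1[OF assms] by simp
  then show "automorphism_coeff a \<noteq> 0" by (simp add: automorphism_coeff_def)
  have "1 + automorphism_coeff a = of_real (1 + sqrt (1 - (ip_norm cinner a)\<^sup>2))"
    by (simp add: automorphism_coeff_def)
  moreover have "1 + sqrt (1 - (ip_norm cinner a)\<^sup>2) \<noteq> 0" using pos by linarith
  ultimately show "1 + automorphism_coeff a \<noteq> 0" by (metis of_real_eq_0_iff)
  show "cinner a a = 1 - automorphism_coeff a * automorphism_coeff a"
    using Cspace.ip_self[OF Cball_Cspace[OF assms]] nrm_square_less_1[OF assms]
    by (simp add: automorphism_coeff_def flip: of_real_mult)
qed (simp add: automorphism_coeff_def)

text \<open>The form \<open>(1 - s) / \<parallel>a\<parallel>\<^sup>2 = 1 / (1 + s)\<close> of the coefficient covers the case \<open>a = 0\<close>.\<close>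

lemma ball_automorphism_eq:
  assumes a: "a \<in> Cball d" and z: "z \<in> Cspace d"
  defines "s \<equiv> automorphism_coeff a"
  shows "ball_automorphism a z =
    (\<lambda>i. inverse (1 - cinner z a) * ((1 - cinner z a / (1 + s)) * a i - s * z i))"
proof -
  have aC: "a \<in> Cspace d" using a by (rule Cball_Cspace)
  have s1: "1 + s \<noteq> 0" unfolding s_def by (rule automorphism_coeff[OF a])
  have \<alpha>: "cinner a a = (1 - s) * (1 + s)"
    using automorphism_coeff(1)[OF a] by (simp add: s_def algebra_simps)
  have "(a i - cinner z a / cinner a a * a i - s * (z i - cinner z a / cinner a a * a i)) =
      (1 - cinner z a / (1 + s)) * a i - s * z i" for i
  proof (cases "cinner a a = 0")
    case True
    then have "a = (\<lambda>_. 0)" using cinner_self_eq_0[OF aC] by simp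
    then show ?thesis by simp
  next
    case False
    then have "1 - s \<noteq> 0" using \<alpha> by auto
    then have eq: "cinner z a / (1 + s) = (1 - s) * (cinner z a / cinner a a)"
      unfolding \<alpha> by simp
    show ?thesis unfolding eq by algebra
  qed
  then show ?thesis
    unfolding ball_automorphism_def orthogonal_projection_line[OF z aC] Let_def s_def
      automorphism_coeff_def by (auto simp: divide_inverse mult.commute)
qed

text \<open>With denominators cleared this is a polynomial identity in \<open>s\<close>,
  \<open>t\<close>, \<open>p\<close>, \<open>q\<close> and \<open>cinner z w\<close>, subject to
  \<open>t * (1 + s) = 1\<close> and \<open>cinner a a = 1 - s * s\<close>. The product form is the
  one needed to take powers factor by factor.\<close>

lemma ball_automorphism_cinner:
  assumes a: "a \<in> Cball d" and z: "z \<in> Cball d" and w: "w \<in> Cball d"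
  shows "(1 - cinner (ball_automorphism a z) (ball_automorphism a w)) * (1 - cinner z a) *
    (1 - cinner a w) = (1 - cinner a a) * (1 - cinner z w)"
proof -
  note C = a[THEN Cball_Cspace] z[THEN Cball_Cspace] w[THEN Cball_Cspace]
  define s where "s = automorphism_coeff a"
  note s = automorphism_coeff[OF a, folded s_def]
  define t where "t = inverse (1 + s)"
  define p where "p = cinner z a"
  define q where "q = cinner a w"
  have cs: "cnj s = s" "cnj t = t" by (simp_all add: s(4) t_def)
  have t: "t * s = 1 - t" using s(3) by (simp add: t_def field_simps)
  have p: "1 - p \<noteq> 0" and q: "1 - q \<noteq> 0"
    using Re_one_minus_cinner[OF z a] Re_one_minus_cinner[OF a w] by (auto simp: p_def q_def)
  have cinner_wa: "cinner w a = cnj q" unfolding q_def by (rule Cspace.ip_commute[OF C(1,3)])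
  have clear: "(1 - inverse (1 - p) * (inverse (1 - q) * N)) * (1 - p) * (1 - q) =
     (1 - p) * (1 - q) - N" for N
    using left_inverse[OF p] left_inverse[OF q] by algebra
  have "cinner (ball_automorphism a z) (ball_automorphism a w) =
     inverse (1 - p) * (inverse (1 - q) *
       ((1 - p * t) * ((1 - q * t) * (1 - s * s) - s * q) - s * ((1 - q * t) * p - s * cinner z w)))"
    unfolding ball_automorphism_eq[OF a C(2)] ball_automorphism_eq[OF a C(3)]
      s_def[symmetric] divide_inverse t_def[symmetric]
    by (simp only: Cspace.ip_linear[where d = d] C)
      (simp add: cs cinner_wa p_def[symmetric] q_def[symmetric] s(1) algebra_simps)
  then have "(1 - cinner (ball_automorphism a z) (ball_automorphism a w)) * (1 - p) * (1 - q) =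
     (1 - p) * (1 - q) -
       ((1 - p * t) * ((1 - q * t) * (1 - s * s) - s * q) - s * ((1 - q * t) * p - s * cinner z w))"
    by (simp only: clear)
  also have "\<dots> = s * s * (1 - cinner z w)" using t by algebra
  finally show ?thesis by (simp add: s(1) p_def q_def)
qed

text \<open>The preceding identity with \<open>w = z\<close> makes
  \<open>1 - |\<phi>_a(z)|^2\<close> a quotient of positive numbers.\<close>

lemma ball_automorphism_mem:
  assumes a: "a \<in> Cball d" and z: "z \<in> Cball d"
  shows "ball_automorphism a z \<in> Cball d"
proof -
  note C = a[THEN Cball_Cspace] z[THEN Cball_Cspace]
  let ?b = "ball_automorphism a z"
  have bC: "?b \<in> Cspace d"
    unfolding ball_automorphism_eq[OF a C(2)] by (intro Cspace.ip_linear(1-3) C)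
  have "(1 - cinner ?b ?b) * ((1 - cinner z a) * cnj (1 - cinner z a)) =
      (1 - cinner a a) * (1 - cinner z z)"
    using ball_automorphism_cinner[OF a z z] Cspace.ip_commute[OF C(2,1)] by (simp add: mult.assoc)
  then have "complex_of_real ((1 - (ip_norm cinner ?b)\<^sup>2) * (cmod (1 - cinner z a))\<^sup>2) =
      complex_of_real ((1 - (ip_norm cinner a)\<^sup>2) * (1 - (ip_norm cinner z)\<^sup>2))"
    by (simp only: of_real_mult of_real_diff of_real_1 complex_norm_square
        Cspace.ip_self[OF bC, symmetric] Cspace.ip_self[OF C(1), symmetric]
        Cspace.ip_self[OF C(2), symmetric])
  then have "(1 - (ip_norm cinner ?b)\<^sup>2) * (cmod (1 - cinner z a))\<^sup>2 =
      (1 - (ip_norm cinner a)\<^sup>2) * (1 - (ip_norm cinner z)\<^sup>2)"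
    by (simp only: of_real_eq_iff)
  also have "\<dots> > 0"
    using nrm_square_less_1[OF a] nrm_square_less_1[OF z] by simp
  finally have "(ip_norm cinner ?b)\<^sup>2 < 1"
    by (simp add: zero_less_mult_iff)
  then show ?thesis
    using bC Cspace.nrm_nonneg[OF bC] by (simp add: Cball_def abs_square_less_1)
qed

lemma ball_automorphism_zero: "ball_automorphism a (\<lambda>_. 0) = a" if "a \<in> Cball d"
proof -
  have "cinner (\<lambda>_. 0) a = 0" by (simp add: cinner_def)
  then show ?thesis
    using ball_automorphism_eq[OF that Cball_Cspace[OF zero_Cball]] by simp
qed

text \<open>The denominator of the second application is \<open>1 - r = s^2 / (1 - p)\<close>; its
  reciprocal cancels both the denominator of the first and the factor \<open>s^2\<close> left in
  front of \<open>z\<close>. The involution recovers \<open>\<phi>\<close> from its composite with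
  the automorphism.\<close>

lemma ball_automorphism_involution:
  assumes a: "a \<in> Cball d" and z: "z \<in> Cball d"
  shows "ball_automorphism a (ball_automorphism a z) = z"
proof -
  note C = a[THEN Cball_Cspace] z[THEN Cball_Cspace]
  let ?b = "ball_automorphism a z"
  have bC: "?b \<in> Cspace d" using ball_automorphism_mem[OF a z] by (rule Cball_Cspace)
  define s where "s = automorphism_coeff a"
  note s = automorphism_coeff[OF a, folded s_def]
  define t where "t = inverse (1 + s)"
  define p where "p = cinner z a"
  have t: "t * s = 1 - t" using s(3) by (simp add: t_def field_simps)
  have p: "1 - p \<noteq> 0" using Re_one_minus_cinner[OF z a] by (auto simp: p_def)
  have b: "?b = (\<lambda>i. inverse (1 - p) * ((1 - p * t) * a i - s * z i))"
    unfolding ball_automorphism_eq[OF a C(2)] s_def[symmetric] divide_inverse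
      t_def[symmetric] p_def[symmetric] ..
  define r where "r = cinner ?b a"
  have "r = inverse (1 - p) * ((1 - p * t) * (1 - s * s) - s * p)"
    unfolding r_def b by (simp add: Cspace.ip_linear[where d = d] C s(1) p_def[symmetric])
  also have "(1 - p * t) * (1 - s * s) - s * p = 1 - p - s * s" using t by algebra
  finally have r: "1 - r = s * s * inverse (1 - p)"
    using p by (simp add: field_simps)
  have "inverse (1 - r) * ((1 - r * t) * a i - s * (inverse (1 - p) * ((1 - p * t) * a i - s * z i)))
      = z i" for i
  proof -
    have rp: "(1 - p) * (1 - r) = s * s" using r p by simp
    have "(1 - p) * ((1 - r * t) * a i - s * (inverse (1 - p) * ((1 - p * t) * a i - s * z i))) =
        (1 - p) * (1 - r * t) * a i - s * ((1 - p * t) * a i - s * z i)"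
      using p by (simp add: field_simps)
    also have "\<dots> = s * s * z i"
      using rp t by algebra
    finally show ?thesis using p s(2) unfolding r by (simp add: field_simps)
  qed
  then show ?thesis
    unfolding ball_automorphism_eq[OF a bC] s_def[symmetric] divide_inverse
      t_def[symmetric] r_def[symmetric] unfolding b by simp
qed

section \<open>The kernel of the ball\<close>

text \<open>All four factors have arguments in \<open>(-\<pi>/2, \<pi>/2)\<close>, so their logarithms can only differ
  by less than \<open>2\<pi>\<close> in the imaginary part.\<close>

lemma powr_mult_right_half_plane:
  fixes u v p q e :: complex and r :: real
  assumes "0 < Re u" "0 < Re v" "0 < Re p" "0 < Re q" "0 < r"
    and eq: "u * p * q = of_real r * v"
  shows "u powr e * p powr e * q powr e = of_real r powr e * v powr e"
proof -
  have nz: "u \<noteq> 0" "v \<noteq> 0" "p \<noteq> 0" "q \<noteq> 0" using assms by auto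
  have "Ln u + Ln p + Ln q = Ln (of_real r) + Ln v"
  proof (rule exp_complex_eqI)
    show "exp (Ln u + Ln p + Ln q) = exp (Ln (of_real r) + Ln v)"
      using nz \<open>0 < r\<close> eq by (simp add: exp_add)
    show "\<bar>Im (Ln u + Ln p + Ln q) - Im (Ln (of_real r) + Ln v)\<bar> < 2 * pi"
      using assms(1-4)[THEN Re_Ln_pos_lt_imp] \<open>0 < r\<close> by (simp add: Ln_of_real)
  qed
  then have "e * Ln u + e * Ln p + e * Ln q = e * Ln (of_real r) + e * Ln v"
    by (simp flip: distrib_left)
  then show ?thesis
    using nz \<open>0 < r\<close> by (simp add: powr_def flip: exp_add)
qed

text \<open>For \<open>|c| > 2\<close> the power is not injective on the unit disc about 1. Close to
  1, however, \<open>c * Ln\<close> has imaginary part below \<open>pi\<close> in modulus, so equal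
  exponentials force equal logarithms. The cap at 1 keeps the bases away from 0.\<close>

lemma powr_inj_near_one:
  fixes c :: real
  assumes "c \<noteq> 0"
  obtains \<epsilon> :: real where "0 < \<epsilon>" "\<epsilon> \<le> 1"
    "\<And>u v :: complex. cmod u < \<epsilon> \<Longrightarrow> cmod v < \<epsilon> \<Longrightarrow>
      (1 - u) powr of_real c = (1 - v) powr of_real c \<Longrightarrow> u = v"
proof -
  have "isCont Ln 1" by (rule continuous_at_Ln) simp
  moreover have "0 < pi / \<bar>c\<bar>" using assms by simp
  ultimately obtain \<eta> where \<eta>: "\<eta> > 0" "\<And>x. dist x 1 < \<eta> \<Longrightarrow> dist (Ln x) (Ln 1) < pi / \<bar>c\<bar>"
    unfolding continuous_at_eps_delta by blast
  show thesis
  proof (rule that)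
    show "0 < min \<eta> 1" "min \<eta> 1 \<le> 1" using \<eta>(1) by auto
    fix u v :: complex
    assume u: "cmod u < min \<eta> 1" and v: "cmod v < min \<eta> 1"
      and eq: "(1 - u) powr of_real c = (1 - v) powr of_real c"
    have nz: "1 - u \<noteq> 0" "1 - v \<noteq> 0" using u v by auto
    have Im: "\<bar>c * Im (Ln (1 - x))\<bar> < pi" if "cmod x < min \<eta> 1" for x
    proof -
      have "cmod (Ln (1 - x)) < pi / \<bar>c\<bar>" using \<eta>(2)[of "1 - x"] that by (simp add: dist_norm)
      then have "\<bar>Im (Ln (1 - x))\<bar> < pi / \<bar>c\<bar>" using abs_Im_le_cmod order.strict_trans1 by blast
      then show ?thesis using assms by (simp add: abs_mult field_simps)
    qed
    have "of_real c * Ln (1 - u) = of_real c * Ln (1 - v)"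
    proof (rule exp_complex_eqI)
      show "exp (of_real c * Ln (1 - u)) = exp (of_real c * Ln (1 - v))"
        using eq nz by (simp add: powr_def)
      show "\<bar>Im (of_real c * Ln (1 - u)) - Im (of_real c * Ln (1 - v))\<bar> < 2 * pi"
        using Im[OF u] Im[OF v] by simp
    qed
    then have "Ln (1 - u) = Ln (1 - v)" using assms by simp
    then have "1 - u = 1 - v" using nz exp_Ln by metis
    then show "u = v" by simp
  qed
qed

text \<open>Diagonal values are powers of positive reals: their square roots are real, and they
  determine the norm.\<close>

lemma ball_kernel_self:
  assumes "z \<in> Cball d"
  shows "ball_kernel \<gamma> z z = of_real ((1 - (ip_norm cinner z)\<^sup>2) powr - \<gamma>)"
proof -
  have "1 - cinner z z = of_real (1 - (ip_norm cinner z)\<^sup>2)"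
    using Cspace.ip_self[OF Cball_Cspace[OF assms]] by simp
  then show ?thesis
    using nrm_square_less_1[OF assms] powr_of_real[of "1 - (ip_norm cinner z)\<^sup>2" "- \<gamma>"]
    by (simp add: ball_kernel_def)
qed

text \<open>Conjugation commutes with the principal power off the negative real axis.\<close>

lemma ball_kernel_commute:
  assumes "z \<in> Cball d" "w \<in> Cball d"
  shows "ball_kernel \<gamma> w z = cnj (ball_kernel \<gamma> z w)"
  using cnj_powr[of "1 - cinner z w" "- of_real \<gamma>"] Re_one_minus_cinner[OF assms]
    Cspace.ip_commute[OF assms[THEN Cball_Cspace]]
  by (simp add: ball_kernel_def)

lemma ball_kernel_zero: "ball_kernel \<gamma> (\<lambda>_. 0) w = 1"
  by (simp add: ball_kernel_def cinner_def)

lemma ball_kernel_nonzero: "ball_kernel \<gamma> z w \<noteq> 0" if "z \<in> Cball d" "w \<in> Cball d"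
  using Re_one_minus_cinner[OF that] by (auto simp: ball_kernel_def)

text \<open>The factors \<open>ball_kernel \<gamma> z a\<close> and
  \<open>ball_kernel \<gamma> a w\<close> are those supplied by a weight of the stated form, so this
  identity converts the kernel condition for \<open>\<phi>\<close> into the one for the map before
  the automorphism.\<close>

lemma ball_kernel_automorphism:
  assumes a: "a \<in> Cball d" and z: "z \<in> Cball d" and w: "w \<in> Cball d"
  shows "ball_kernel \<gamma> (ball_automorphism a z) (ball_automorphism a w) * ball_kernel \<gamma> z a *
    ball_kernel \<gamma> a w = ball_kernel \<gamma> a a * ball_kernel \<gamma> z w"
proof -
  have aa: "1 - cinner a a = of_real (1 - (ip_norm cinner a)\<^sup>2)"
    using Cspace.ip_self[OF Cball_Cspace[OF a]] by simp
  show ?thesis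
    unfolding ball_kernel_def aa
    by (intro powr_mult_right_half_plane Re_one_minus_cinner[of _ d] ball_automorphism_mem a z w)
      (use nrm_square_less_1[OF a] ball_automorphism_cinner[OF a z w] aa in simp_all)
qed

text \<open>
  The kernel determines \<open>\<langle>z, w\<rangle>\<close> only when this number is small. The diagonal gives
  \<open>\<parallel>\<psi> z\<parallel> = \<parallel>z\<parallel>\<close>, so \<open>\<psi>\<close> preserves \<open>\<langle>z, w\<rangle>\<close> for small \<open>w\<close>; with the equality case of
  Cauchy-Schwarz this makes \<open>\<psi>\<close> homogeneous.
\<close>

lemma ball_kernel_preserving_cinner:
  assumes "\<gamma> > 0" and \<psi>: "\<And>z. z \<in> Cball d \<Longrightarrow> \<psi> z \<in> Cball d"
    and K: "\<And>z w. z \<in> Cball d \<Longrightarrow> w \<in> Cball d \<Longrightarrow>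
      ball_kernel \<gamma> (\<psi> z) (\<psi> w) = ball_kernel \<gamma> z w"
    and z: "z \<in> Cball d" and w: "w \<in> Cball d"
  shows "cinner (\<psi> z) (\<psi> w) = cinner z w"
proof -
  have nrm: "ip_norm cinner (\<psi> z) = ip_norm cinner z" if z: "z \<in> Cball d" for z
  proof -
    let ?x = "1 - (ip_norm cinner (\<psi> z))\<^sup>2" and ?y = "1 - (ip_norm cinner z)\<^sup>2"
    have pos: "0 < ?x" "0 < ?y" using nrm_square_less_1 \<psi>[OF z] z by fastforce+
    have "?x powr - \<gamma> = ?y powr - \<gamma>"
      using K[OF z z] unfolding ball_kernel_self[OF z] ball_kernel_self[OF \<psi>[OF z]] by simp
    from arg_cong[OF this, of ln] have "ln ?x = ln ?y" using pos \<open>\<gamma> > 0\<close> by (simp add: ln_powr)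
    then have "(ip_norm cinner (\<psi> z))\<^sup>2 = (ip_norm cinner z)\<^sup>2"
      using ln_inj_iff[OF pos] by simp
    then show ?thesis
      using Cspace.nrm_nonneg[OF Cball_Cspace[OF z]] Cspace.nrm_nonneg[OF Cball_Cspace[OF \<psi>[OF z]]]
      by simp
  qed
  obtain \<epsilon> where \<epsilon>: "0 < \<epsilon>" "\<epsilon> \<le> 1"
    and inj: "\<And>u v :: complex. cmod u < \<epsilon> \<Longrightarrow> cmod v < \<epsilon> \<Longrightarrow>
      (1 - u) powr of_real (- \<gamma>) = (1 - v) powr of_real (- \<gamma>) \<Longrightarrow> u = v"
    using powr_inj_near_one[of "- \<gamma>"] \<open>\<gamma> > 0\<close> by (metis less_irrefl neg_equal_0_iff_equal)
  \<comment> \<open>One small argument suffices: the other has norm below 1, and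
    \<open>\<psi>\<close> keeps the small norm.\<close>
  have small: "cinner (\<psi> z) (\<psi> w) = cinner z w"
    if z: "z \<in> Cball d" and w: "w \<in> Cball d" and w_small: "ip_norm cinner w < \<epsilon>" for z w
  proof (rule inj)
    have *: "cmod (cinner x y) < \<epsilon>"
      if x: "x \<in> Cball d" and y: "y \<in> Cball d" "ip_norm cinner y < \<epsilon>" for x y
    proof -
      have "cmod (cinner x y) \<le> ip_norm cinner x * ip_norm cinner y"
        using x y(1) by (intro Cspace.cauchy_schwarz Cball_Cspace)
      also have "\<dots> \<le> ip_norm cinner y"
        using Cball_nrm[OF x] Cspace.nrm_nonneg[OF Cball_Cspace[OF y(1)]]
        by (simp add: mult_left_le_one_le Cspace.nrm_nonneg[OF Cball_Cspace[OF x]])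
      finally show ?thesis using y(2) by simp
    qed
    show "cmod (cinner z w) < \<epsilon>" using z w w_small by (rule *)
    show "cmod (cinner (\<psi> z) (\<psi> w)) < \<epsilon>"
      using z w w_small by (intro * \<psi>) (simp_all add: nrm)
    show "(1 - cinner (\<psi> z) (\<psi> w)) powr of_real (- \<gamma>) = (1 - cinner z w) powr of_real (- \<gamma>)"
      using K[OF z w] by (simp add: ball_kernel_def)
  qed
  define t where "t = \<epsilon> / 2"
  have t: "0 < t" "t < \<epsilon>" "t \<le> 1" using \<epsilon> by (auto simp: t_def)
  have scaled: "(\<lambda>i. of_real t * z i) \<in> Cball d" (is ?A)
    and scaled_nrm: "ip_norm cinner (\<lambda>i. of_real t * z i) = t * ip_norm cinner z" (is ?B)
    and scaled_small: "ip_norm cinner (\<lambda>i. of_real t * z i) < \<epsilon>" (is ?C)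
    if z: "z \<in> Cball d" for z
  proof -
    show ?A using z t by (intro Cball_scale) auto
    show B: ?B using t Cspace.nrm_scale[OF Cball_Cspace[OF z]] by simp
    have "t * ip_norm cinner z \<le> t * 1"
      using t Cball_nrm[OF z] by (intro mult_left_mono) auto
    then show ?C using B t by linarith
  qed
  have hom: "(\<lambda>i. of_real t * \<psi> z i) = \<psi> (\<lambda>i. of_real t * z i)" (is "?f = ?g") if z: "z \<in> Cball d" for z
  proof -
    note C = Cball_Cspace[OF z] Cball_Cspace[OF \<psi>[OF z]]
      Cball_Cspace[OF scaled[OF z]] Cball_Cspace[OF \<psi>[OF scaled[OF z]]]
    have f: "?f \<in> Cspace d" using C(2) by (rule Cspace_scale)
    have "cinner ?f ?g = of_real t * cinner (\<psi> z) ?g"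
      using C by (simp add: Cspace.ip_scale[where d = d])
    \<comment> \<open>Only the second vector has to be small, so \<open>z\<close> can be paired with
      its own multiple. The inner product and both squared norms then equal
      \<open>t^2 |z|^2\<close>, which makes the distance zero.\<close>
    also have "cinner (\<psi> z) ?g = cinner z (\<lambda>i. of_real t * z i)"
      using z scaled[OF z] scaled_small[OF z] by (rule small)
    also have "\<dots> = of_real t * of_real ((ip_norm cinner z)\<^sup>2)"
      using C Cspace.ip_self[OF C(1)] by (simp add: Cspace.ip_scale_right[where d = d])
    finally have "Re (cinner ?f ?g) = t\<^sup>2 * (ip_norm cinner z)\<^sup>2"
      by (simp add: power2_eq_square)
    moreover have "(ip_norm cinner ?f)\<^sup>2 = t\<^sup>2 * (ip_norm cinner z)\<^sup>2"
      using Cspace.nrm_scale[OF C(2)] nrm[OF z] by (simp add: power_mult_distrib)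
    moreover have "(ip_norm cinner ?g)\<^sup>2 = t\<^sup>2 * (ip_norm cinner z)\<^sup>2"
      unfolding nrm[OF scaled[OF z]] scaled_nrm[OF z] by (simp add: power_mult_distrib)
    ultimately have "(ip_norm cinner (\<lambda>i. ?f i - ?g i))\<^sup>2 = 0"
      using Cspace.nrm_diff_square[OF f C(4)] by simp
    then have "(\<lambda>i. ?f i - ?g i) = (\<lambda>_. 0)"
      by (intro Cspace.nrm_eq_0[of _ d] Cspace.diff_mem f C(4)) simp
    then show ?thesis by (simp add: fun_eq_iff)
  qed
  note C = Cball_Cspace[OF z] Cball_Cspace[OF w] Cball_Cspace[OF \<psi>[OF z]] Cball_Cspace[OF \<psi>[OF w]]
  \<comment> \<open>Homogeneity moves \<open>t\<close> inside \<open>\<psi>\<close>, where the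
    second argument is small; dividing by \<open>t\<close> afterwards removes the smallness.\<close>
  have "cinner (\<psi> z) (\<lambda>i. of_real t * \<psi> w i) = cinner z (\<lambda>i. of_real t * w i)"
    unfolding hom[OF w] using z scaled[OF w] scaled_small[OF w] by (rule small)
  then have "of_real t * cinner (\<psi> z) (\<psi> w) = of_real t * cinner z w"
    using Cspace.ip_scale_right[OF C(4,3), of "of_real t"] Cspace.ip_scale_right[OF C(2,1), of "of_real t"]
    by simp
  then show ?thesis using t by simp
qed

lemma ball_isometry_extends:
  assumes \<psi>: "\<And>z. z \<in> Cball d \<Longrightarrow> \<psi> z \<in> Cball d"
    and ip: "\<And>z w. z \<in> Cball d \<Longrightarrow> w \<in> Cball d \<Longrightarrow> cinner (\<psi> z) (\<psi> w) = cinner z w"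
  obtains V where "linear_isometry_on (Cspace d) cinner V" "\<And>z. z \<in> Cball d \<Longrightarrow> V z = \<psi> z"
proof -
  \<comment> \<open>This factor brings every vector of the space into the ball; being real and
    nonzero, it can be pulled out of both arguments of \<open>cinner\<close> and cancelled.\<close>
  define r where "r = (\<lambda>z. complex_of_real (1 / (1 + ip_norm cinner z)))"
  define V where "V = (\<lambda>z i. inverse (r z) * \<psi> (\<lambda>i. r z * z i) i)"
  have r0: "r z \<noteq> 0" and cnj_r: "cnj (r z) = r z" and rz: "(\<lambda>i. r z * z i) \<in> Cball d"
    if z: "z \<in> Cspace d" for z
  proof -
    have pos: "1 + ip_norm cinner z > 0" using Cspace.nrm_nonneg[OF z] by simp
    then have "1 + ip_norm cinner z \<noteq> 0" by simp
    then show "r z \<noteq> 0" unfolding r_def of_real_eq_0_iff by simp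
    show "cnj (r z) = r z" by (simp add: r_def)
    have "cmod (r z) = 1 / (1 + ip_norm cinner z)"
      unfolding r_def norm_of_real using pos by simp
    then have "ip_norm cinner (\<lambda>i. r z * z i) < 1"
      using pos by (simp add: Cspace.nrm_scale[OF z])
    then show "(\<lambda>i. r z * z i) \<in> Cball d" using z by (simp add: Cball_def Cspace_scale)
  qed
  have VC: "V z \<in> Cspace d" if "z \<in> Cspace d" for z
    unfolding V_def by (intro Cspace_scale Cball_Cspace \<psi> rz that)
  have V_ip: "cinner (V z) (V w) = cinner z w" if z: "z \<in> Cspace d" and w: "w \<in> Cspace d" for z w
    unfolding V_def using z w Cball_Cspace[OF \<psi>[OF rz[OF z]]] Cball_Cspace[OF \<psi>[OF rz[OF w]]]
      r0[OF z] r0[OF w] cnj_r[OF z] cnj_r[OF w]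
    by (simp add: Cspace.ip_linear[where d = d] ip rz) (simp add: field_simps)
  have "linear_isometry_on (Cspace d) cinner V"
    using VC V_ip by (intro Cspace.linear_isometryI) auto
  moreover have "V z = \<psi> z" if z: "z \<in> Cball d" for z
  proof -
    note C = Cball_Cspace[OF z]
    note C' = C VC[OF C] Cball_Cspace[OF \<psi>[OF z]] Cball_Cspace[OF \<psi>[OF rz[OF C]]]
    \<comment> \<open>All four inner products formed from \<open>V z\<close> and
      \<open>\<psi> z\<close> equal \<open>cinner z z\<close>, so their squared distance
      vanishes.\<close>
    have "cinner (V z) (\<psi> z) = cinner z z" "cinner (\<psi> z) (V z) = cinner z z"
      unfolding V_def using z C' r0[OF C] cnj_r[OF C]
      by (simp_all add: Cspace.ip_linear[where d = d] ip rz)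
    then have "cinner (\<lambda>i. V z i - \<psi> z i) (\<lambda>i. V z i - \<psi> z i) = 0"
      using C' by (simp add: Cspace.ip_linear[where d = d] ip z V_ip)
    then have "(\<lambda>i. V z i - \<psi> z i) = (\<lambda>_. 0)"
      using C' by (intro Cspace.ip_definite[of _ d] Cspace.diff_mem)
    then show ?thesis by (simp add: fun_eq_iff)
  qed
  ultimately show thesis by (rule that)
qed

theorem theorem4p1:
  fixes d :: enat and \<gamma> :: real
    and H :: "((nat \<Rightarrow> complex) \<Rightarrow> complex) set"
    and ip :: "((nat \<Rightarrow> complex) \<Rightarrow> complex) \<Rightarrow> ((nat \<Rightarrow> complex) \<Rightarrow> complex) \<Rightarrow> complex"
    and \<phi> :: "(nat \<Rightarrow> complex) \<Rightarrow> (nat \<Rightarrow> complex)"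
    and \<delta> :: "(nat \<Rightarrow> complex) \<Rightarrow> complex"
  assumes "0 < \<gamma>"
    and "reproducing_kernel_hilbert_space H ip (Cball d) (ball_kernel \<gamma>)"
    and "\<phi> \<in> Cball d \<rightarrow> Cball d"
  shows "coisometry_on H ip (weighted_composition (Cball d) \<delta> \<phi>) \<longleftrightarrow>
    (\<exists>a\<in>Cball d. \<exists>V. linear_isometry_on (Cspace d) cinner V \<and>
       (\<forall>z\<in>Cball d. \<phi> z = ball_automorphism a (V z)) \<and>
       (\<exists>\<mu>::complex. cmod \<mu> = 1 \<and>
          (\<forall>z\<in>Cball d. \<delta> z = \<mu> * (ball_kernel \<gamma> (V z) a / csqrt (ball_kernel \<gamma> a a)))))"
    (is "?L \<longleftrightarrow> ?R")
proof -
  interpret reproducing_kernel_hilbert_space H ip "Cball d" "ball_kernel \<gamma>" by (fact assms(2))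
  let ?B = "Cball d" and ?K = "ball_kernel \<gamma>"
  have \<phi>: "\<phi> z \<in> ?B" if "z \<in> ?B" for z using assms(3) that by auto
  have csqrt_mult: "csqrt (?K a a) * csqrt (?K a a) = ?K a a"
    and csqrt_nz: "csqrt (?K a a) \<noteq> 0"
    and cnj_csqrt: "cnj (csqrt (?K a a)) = csqrt (?K a a)" if a: "a \<in> ?B" for a
  proof -
    show "csqrt (?K a a) * csqrt (?K a a) = ?K a a" by (simp flip: power2_eq_square)
    show "csqrt (?K a a) \<noteq> 0" using ball_kernel_nonzero[OF a a] by simp
    show "cnj (csqrt (?K a a)) = csqrt (?K a a)" unfolding ball_kernel_self[OF a] by simp
  qed
  have "?R" if ?L
  proof -
    have K: "\<delta> z * cnj (\<delta> w) * ?K (\<phi> z) (\<phi> w) = ?K z w" if "z \<in> ?B" "w \<in> ?B" for z w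
      using coisometry_imp_kernel_identity[OF assms(3) \<open>?L\<close> that] .
    define z0 where "z0 = (\<lambda>_::nat. 0::complex)"
    have z0: "z0 \<in> ?B" unfolding z0_def by (rule zero_Cball)
    define a where "a = \<phi> z0"
    define c where "c = csqrt (?K a a)"
    have a: "a \<in> ?B" using \<phi>[OF z0] by (simp add: a_def)
    note c = csqrt_mult[OF a, folded c_def] csqrt_nz[OF a, folded c_def] cnj_csqrt[OF a, folded c_def]
    define \<psi> where "\<psi> = (\<lambda>z. ball_automorphism a (\<phi> z))"
    have \<psi>: "\<psi> z \<in> ?B" if "z \<in> ?B" for z
      unfolding \<psi>_def by (intro ball_automorphism_mem a \<phi> that)
    have \<phi>_eq: "\<phi> z = ball_automorphism a (\<psi> z)" if "z \<in> ?B" for z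
      unfolding \<psi>_def using ball_automorphism_involution[OF a \<phi>[OF that]] by simp
    have Kz0: "?K z z0 = 1" "?K z0 z = 1" if "z \<in> ?B" for z
      using ball_kernel_commute[OF z0 that, of \<gamma>] ball_kernel_zero[of \<gamma> z] by (simp_all add: z0_def)
    have \<delta>_z0: "\<delta> z0 * cnj (\<delta> z0) * (c * c) = 1"
      using K[OF z0 z0] Kz0[OF z0] by (simp add: a_def[symmetric] c(1))
    \<comment> \<open>Forced by the required formula at the origin, where \<open>V\<close> vanishes
      and the kernel is 1: it reads \<open>\<delta> z0 = \<mu> / c\<close>.\<close>
    define \<mu> where "\<mu> = \<delta> z0 * c"
    have "\<mu> * cnj \<mu> = 1" using \<delta>_z0 by (simp add: \<mu>_def c(3) mult_ac)
    then have "complex_of_real ((cmod \<mu>)\<^sup>2) = of_real 1"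
      by (simp only: complex_norm_square of_real_1)
    then have "(cmod \<mu>)\<^sup>2 = 1" by (simp only: of_real_eq_iff)
    then have \<mu>: "cmod \<mu> = 1" using norm_ge_zero[of \<mu>] by (auto simp: power2_eq_1_iff)
    have \<delta>: "\<delta> z = \<mu> * (?K (\<psi> z) a / c)" if z: "z \<in> ?B" for z
    proof -
      \<comment> \<open>The automorphism identity with second point \<open>z0\<close>, which the
        automorphism sends to \<open>a\<close>; all kernels against \<open>z0\<close> are 1.\<close>
      have "?K (\<phi> z) a * ?K (\<psi> z) a = c * c"
        using ball_kernel_automorphism[OF a \<psi>[OF z] z0, of \<gamma>] Kz0[OF a] Kz0[OF \<psi>[OF z]]
          ball_automorphism_zero[OF a] \<phi>_eq[OF z] by (simp add: c(1) z0_def)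
      moreover have "\<delta> z * cnj (\<delta> z0) * ?K (\<phi> z) a = 1"
        using K[OF z z0] Kz0[OF z] by (simp add: a_def)
      ultimately have eq: "?K (\<psi> z) a = \<delta> z * cnj (\<delta> z0) * (c * c)" by algebra
      have "\<delta> z0 * ?K (\<psi> z) a = (\<delta> z0 * cnj (\<delta> z0) * (c * c)) * \<delta> z"
        unfolding eq by (simp only: mult_ac)
      then have "\<delta> z = \<delta> z0 * ?K (\<psi> z) a" unfolding \<delta>_z0 by simp
      then show ?thesis using c(2) by (simp add: \<mu>_def)
    qed
    have K_\<psi>: "?K (\<psi> z) (\<psi> w) = ?K z w" if z: "z \<in> ?B" and w: "w \<in> ?B" for z w
    proof -
      have "cnj (\<delta> w) = cnj \<mu> * (?K a (\<psi> w) / c)"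
        using \<delta>[OF w] ball_kernel_commute[OF \<psi>[OF w] a] c(3) by simp
      then have "?K z w = (\<mu> * cnj \<mu>) *
          (?K (\<phi> z) (\<phi> w) * ?K (\<psi> z) a * ?K a (\<psi> w)) / (c * c)"
        using \<delta>[OF z] unfolding K[OF z w, symmetric] by (simp add: mult_ac)
      also have "?K (\<phi> z) (\<phi> w) * ?K (\<psi> z) a * ?K a (\<psi> w) = c * c * ?K (\<psi> z) (\<psi> w)"
        using ball_kernel_automorphism[OF a \<psi>[OF z] \<psi>[OF w], of \<gamma>] \<phi>_eq[OF z] \<phi>_eq[OF w] c(1)
        by simp
      finally show ?thesis using \<open>\<mu> * cnj \<mu> = 1\<close> c(2) by simp
    qed
    have \<psi>_ip: "cinner (\<psi> z) (\<psi> w) = cinner z w" if "z \<in> ?B" "w \<in> ?B" for z w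
      by (rule ball_kernel_preserving_cinner[of \<gamma> d \<psi>]) (fact assms(1) \<psi> K_\<psi> that)+
    obtain V where "linear_isometry_on (Cspace d) cinner V" "\<And>z. z \<in> ?B \<Longrightarrow> V z = \<psi> z"
      using ball_isometry_extends[of d \<psi>, OF \<psi> \<psi>_ip] by blast
    then show ?R
      using a \<mu> \<delta> \<phi>_eq unfolding c_def by (intro bexI[of _ a] exI[of _ V] exI[of _ \<mu>] conjI ballI) auto
  qed
  moreover have "?L" if ?R
  proof -
    obtain a V \<mu> where a: "a \<in> ?B" and V: "linear_isometry_on (Cspace d) cinner V"
      and \<phi>_eq: "\<And>z. z \<in> ?B \<Longrightarrow> \<phi> z = ball_automorphism a (V z)" and \<mu>: "cmod \<mu> = 1"
      and \<delta>: "\<And>z. z \<in> ?B \<Longrightarrow> \<delta> z = \<mu> * (?K (V z) a / csqrt (?K a a))"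
      using \<open>?R\<close> by blast
    define c where "c = csqrt (?K a a)"
    note \<delta> = \<delta>[folded c_def]
    note c = csqrt_mult[OF a, folded c_def] csqrt_nz[OF a, folded c_def] cnj_csqrt[OF a, folded c_def]
    have VB: "V z \<in> ?B" if "z \<in> ?B" for z
      using V that by (auto simp: linear_isometry_on_def linear_map_on_def Cball_def)
    have \<mu>1: "\<mu> * cnj \<mu> = 1" using \<mu> by (simp add: complex_norm_square[symmetric])
    \<comment> \<open>The same cancellation of weights, with \<open>V\<close> in place of
      \<open>\<psi>\<close>; it ends because \<open>V\<close> preserves inner products and hence the
      kernel.\<close>
    have "\<delta> z * cnj (\<delta> w) * ?K (\<phi> z) (\<phi> w) = ?K z w" if z: "z \<in> ?B" and w: "w \<in> ?B" for z w
    proof -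
      have "cnj (\<delta> w) = cnj \<mu> * (?K a (V w) / c)"
        using \<delta>[OF w] ball_kernel_commute[OF VB[OF w] a] c(3) by simp
      then have "\<delta> z * cnj (\<delta> w) * ?K (\<phi> z) (\<phi> w) = (\<mu> * cnj \<mu>) *
          (?K (\<phi> z) (\<phi> w) * ?K (V z) a * ?K a (V w)) / (c * c)"
        using \<delta>[OF z] by (simp add: mult_ac)
      also have "?K (\<phi> z) (\<phi> w) * ?K (V z) a * ?K a (V w) = c * c * ?K (V z) (V w)"
        using ball_kernel_automorphism[OF a VB[OF z] VB[OF w], of \<gamma>] \<phi>_eq[OF z] \<phi>_eq[OF w] c(1) by simp
      also have "?K (V z) (V w) = ?K z w"
        using Cspace.isometry_preserves_ip[OF V Cball_Cspace[OF z] Cball_Cspace[OF w]]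
        by (simp add: ball_kernel_def)
      finally show ?thesis using \<mu>1 c(2) by simp
    qed
    then show ?L by (rule kernel_identity_imp_coisometry[OF assms(3)])
  qed
  ultimately show ?thesis by blast
qed

end
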